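(* Let $\mathcal{G}(L)$ be a tropical basis for $L^\circ$ whose elements are dehomogenizations of linear forms (in $y_0,\dots,y_m$, with respect to $y_0$). Then a tropical basis for $X(L)^\circ$ which generates the ideal $J(L)\subset S$ may be constructed by taking generators of the toric ideal of $X(C)\subset\mathbb{A}^n$ (the kernel of $S\to A(C)$), along with lifts to $S$ of the generators $$(g z^v)\cdot\chi^u,\qquad g\in\mathcal{G}(L),\ (u,v)\in\mathcal{P},$$ of the ideal $\widetilde I(L)\subset A(C)$.
   Context: $\mathbb{K}$ is an algebraically closed, trivially valued field; $T$ is an algebraic torus with character lattice $M$ and cocharacter lattice $N$. Fix a pointed polyhedral cone $\sigma\subset N_\mathbb{Q}$, and $\Delta_0,\dots,\Delta_m$, each either empty or a polyhedron in $N_\mathbb{Q}$ with tailcone $\{v:\Delta_i+v\subseteq\Delta_i\}=\sigma$, with $\sum_i\Delta_i\subsetneq\sigma$. For $u\in\sigma^\vee$, $\Delta_i(u)=\min_{v\in\Delta_i}\langle v,u\rangle$, and $\Delta_i(u)=\infty$ if $\Delta_i=\emptyset$ (a coefficient $\infty$ in a divisor allows poles of arbitrary order). Let $e_1,\dots,e_m$ be the standard basis of $\mathbb{Q}^m$, $e_0=-\sum_{i\ge1}e_i$, $C\subset N_\mathbb{Q}\times\mathbb{Q}^m$ the cone generated by $\sigma\times0$ and all $\Delta_i\times e_i$, $A(C)=\mathbb{K}[C^\vee\cap(M\times\mathbb{Z}^m)]$ with monomials $\chi^{(u,v)}=z^v\chi^u$, and $X(C)=\mathrm{Spec}\,A(C)$.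 Let $L\subset\mathbb{P}^m=\mathrm{Proj}\,\mathbb{K}[y_0,\dots,y_m]$ be a line meeting the dense torus $(\mathbb{K}^* )^m$ with coordinates $z_i=y_i/y_0$; $L^\circ=L\cap(\mathbb{K}^* )^m$ with ideal $I(L)\subset\mathbb{K}[z_1^{\pm1},\dots,z_m^{\pm1}]$; $Q_i$ the restriction of $V(y_i)$ to $L$; $A(L)=\bigoplus_{u\in\sigma^\vee\cap M}H^0(L,\mathcal{O}(\sum_i\lfloor\Delta_i(u)\rfloor Q_i))\cdot\chi^u$, and $X(L)=\mathrm{Spec}\,A(L)$, embedded in $X(C)$ via the surjection $A(C)\to A(L)$, $z^v\chi^u\mapsto z^v|_L\chi^u$. Its kernel is $\widetilde I(L)$, the ideal generated by all $f\chi^u\in A(C)$ with $u\in M$, $f\in I(L)$. Fix a finite generating set $H$ of $C^\vee\cap(M\times\mathbb{Z}^m)$, $n=\#H$, $S=\mathbb{K}[x_h\mid h\in H]$, with $S\to A(C)$, $x_h\mapsto\chi^h$. $J(L)\subset S$ is the kernel of $S\to A(C)\to A(L)$, i.e. the ideal of $X(L)\subset\mathbb{A}^n$; $X(L)^\circ=X(L)\cap(\mathbb{K}^* )^n$. Let $P\subset M_\mathbb{Q}\times\mathbb{Q}^m$ be the (possibly unbounded) polyhedron of all $(u,v)$ with $u\in\sigma^\vee$, $v_i\ge-\Delta_i(u)$ for $i=1,\dots,m$, and $\sum_{i=1}^mv_i\le\Delta_0(u)-1$. $\mathcal{P}\subset P\cap(M\times\mathbb{Z}^m)$ is a set of lattice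 generators for $P$ as a $C^\vee$-module: every lattice point of $P$ is a sum of an element of $\mathcal{P}$ and a lattice point of $C^\vee$. For a closed subvariety $Z\subset(\mathbb{K}^* )^k$ with ideal $I$, $\mathrm{Trop}(Z)$ is the set of $w\in\mathbb{R}^k$ such that $\mathrm{In}_w(I)$ (generated by the sums of minimal-$w$-weight terms of elements of $I$) contains no monomial. A tropical basis for $Z$ is a subset $G\subset I$ with $\mathrm{Trop}(Z)=\bigcap_{f\in G}\mathrm{Trop}(V(f))$.
   Formalization: For the tropical-basis claim the toric generators are taken to be binomials and the lifts monomial by monomial (distinct terms have distinct images), since arbitrary choices can fail; such choices are shown to exist, and generation of J(L) is proved for arbitrary generators and lifts. *)

theory Defs
  imports
    "HOL-Library.Poly_Mapping"
    "HOL-Library.Extended_Real"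
    "HOL-Library.Product_Plus"
    "HOL-Library.Set_Algebras"
    "HOL-Computational_Algebra.Polynomial"
begin

text \<open>
  Bases of the lattices are fixed, so that \<open>M = N = \<int>\<^sup>d\<close> with the standard pairing; coordinates of
  \<open>M\<close> and \<open>N\<close> carry the indices \<open>1, \<dots>, d\<close>, those of \<open>\<int>\<^sup>m\<close> the indices \<open>1, \<dots>, m\<close>, and
  homogeneous coordinates on \<open>\<bbbP>\<^sup>m\<close> the indices \<open>0, \<dots>, m\<close>.  A vector with coordinates indexed by
  a set \<open>I\<close> is a finitely supported function that vanishes off \<open>I\<close>.
\<close>

type_synonym qvec = "nat \<Rightarrow>\<^sub>0 rat"
type_synonym zvec = "nat \<Rightarrow>\<^sub>0 int"

definition vecs :: "'i set \<Rightarrow> ('i \<Rightarrow>\<^sub>0 'b::zero) set" where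
  "vecs I = {v. Poly_Mapping.keys v \<subseteq> I}"

definition pairing :: "qvec \<Rightarrow> qvec \<Rightarrow> rat" where
  "pairing v u = (\<Sum>i\<in>Poly_Mapping.keys v. Poly_Mapping.lookup v i * Poly_Mapping.lookup u i)"


section \<open>Polyhedral data\<close>

definition rat_polyhedron :: "nat \<Rightarrow> qvec set \<Rightarrow> bool" where
  "rat_polyhedron d X \<longleftrightarrow>
     (\<exists>A. finite A \<and> A \<subseteq> vecs {1..d} \<times> UNIV \<and>
          X = {v \<in> vecs {1..d}. \<forall>(a, b)\<in>A. b \<le> pairing v a})"

definition rat_polyhedral_cone :: "nat \<Rightarrow> qvec set \<Rightarrow> bool" where
  "rat_polyhedral_cone d X \<longleftrightarrow>
     (\<exists>A. finite A \<and> A \<subseteq> vecs {1..d} \<and>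
          X = {v \<in> vecs {1..d}. \<forall>a\<in>A. 0 \<le> pairing v a})"

definition pointed_cone :: "qvec set \<Rightarrow> bool" where
  "pointed_cone X \<longleftrightarrow> X \<inter> uminus ` X = {0}"

definition tailcone :: "qvec set \<Rightarrow> qvec set" where
  "tailcone X = {v. \<forall>x\<in>X. x + v \<in> X}"

definition dual_cone :: "nat \<Rightarrow> qvec set \<Rightarrow> qvec set" where
  "dual_cone d X = {u \<in> vecs {1..d}. \<forall>v\<in>X. 0 \<le> pairing v u}"

text \<open>
  The evaluation \<open>\<Delta>(u) = min {\<langle>v, u\<rangle> | v \<in> \<Delta>}\<close>.  For \<open>u\<close> in the dual of the tailcone the minimum
  is attained whenever \<open>\<Delta>\<close> is nonempty, hence is the infimum; the infimum over the empty
  polyhedron is \<open>\<infinity>\<close>, as required.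
\<close>

definition poly_eval :: "qvec set \<Rightarrow> qvec \<Rightarrow> ereal" where
  "poly_eval X u = (INF v\<in>X. ereal (of_rat (pairing v u)))"

text \<open>The vectors \<open>e\<^sub>1, \<dots>, e\<^sub>m\<close> and \<open>e\<^sub>0 = - (e\<^sub>1 + \<dots> + e\<^sub>m)\<close>.\<close>

definition evec :: "nat \<Rightarrow> nat \<Rightarrow> qvec" where
  "evec m i = (if i = 0 then - (\<Sum>j\<in>{1..m}. Poly_Mapping.single j 1) else Poly_Mapping.single i 1)"

definition qscale :: "rat \<Rightarrow> qvec \<times> qvec \<Rightarrow> qvec \<times> qvec" where
  "qscale c x = (Poly_Mapping.map ((*) c) (fst x), Poly_Mapping.map ((*) c) (snd x))"

definition generated_cone :: "(qvec \<times> qvec) set \<Rightarrow> (qvec \<times> qvec) set" where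
  "generated_cone X =
     {\<Sum>x\<in>F. qscale (c x) x | F c. finite F \<and> F \<subseteq> X \<and> (\<forall>x\<in>F. 0 \<le> c x)}"

definition coneC :: "nat \<Rightarrow> qvec set \<Rightarrow> (nat \<Rightarrow> qvec set) \<Rightarrow> (qvec \<times> qvec) set" where
  "coneC m \<sigma> \<Delta> = generated_cone (\<sigma> \<times> {0} \<union> (\<Union>i\<le>m. \<Delta> i \<times> {evec m i}))"

definition coneC_dual :: "nat \<Rightarrow> nat \<Rightarrow> qvec set \<Rightarrow> (nat \<Rightarrow> qvec set) \<Rightarrow> (qvec \<times> qvec) set" where
  "coneC_dual d m \<sigma> \<Delta> =
     {(u, v) \<in> vecs {1..d} \<times> vecs {1..m}. \<forall>(x, y)\<in>coneC m \<sigma> \<Delta>. 0 \<le> pairing x u + pairing y v}"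

definition polyP :: "nat \<Rightarrow> nat \<Rightarrow> qvec set \<Rightarrow> (nat \<Rightarrow> qvec set) \<Rightarrow> (qvec \<times> qvec) set" where
  "polyP d m \<sigma> \<Delta> =
     {(u, v) \<in> dual_cone d \<sigma> \<times> vecs {1..m}.
        (\<forall>i\<in>{1..m}. - poly_eval (\<Delta> i) u \<le> ereal (of_rat (Poly_Mapping.lookup v i))) \<and>
        ereal (of_rat (\<Sum>i\<in>{1..m}. Poly_Mapping.lookup v i)) \<le> poly_eval (\<Delta> 0) u - 1}"

definition lattice_points :: "nat \<Rightarrow> nat \<Rightarrow> (qvec \<times> qvec) set \<Rightarrow> (zvec \<times> zvec) set" where
  "lattice_points d m X =
     {(u, v) \<in> vecs {1..d} \<times> vecs {1..m}.
        (Poly_Mapping.map rat_of_int u, Poly_Mapping.map rat_of_int v) \<in> X}"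

definition module_generators ::
    "nat \<Rightarrow> nat \<Rightarrow> qvec set \<Rightarrow> (nat \<Rightarrow> qvec set) \<Rightarrow> (zvec \<times> zvec) set \<Rightarrow> bool" where
  "module_generators d m \<sigma> \<Delta> Ps \<longleftrightarrow>
     Ps \<subseteq> lattice_points d m (polyP d m \<sigma> \<Delta>) \<and>
     (\<forall>q\<in>lattice_points d m (polyP d m \<sigma> \<Delta>).
        \<exists>p\<in>Ps. \<exists>c\<in>lattice_points d m (coneC_dual d m \<sigma> \<Delta>). q = p + c)"


section \<open>Laurent polynomials, ideals and tropicalization\<close>

text \<open>
  An element of \<open>('i \<Rightarrow>\<^sub>0 int) \<Rightarrow>\<^sub>0 'k\<close> is a Laurent polynomial with variables from \<open>'i\<close>: a finitely
  supported family of coefficients, indexed by exponent vectors.  Only the variables in a given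
  set are used, and the polynomial ring is the subring with nonnegative exponents, so that no
  separate embedding into the Laurent polynomial ring is needed.
\<close>

type_synonym ('i, 'k) laurent = "('i \<Rightarrow>\<^sub>0 int) \<Rightarrow>\<^sub>0 'k"

definition laurent_ring :: "'i set \<Rightarrow> ('i, 'k::zero) laurent set" where
  "laurent_ring I = {f. Poly_Mapping.keys f \<subseteq> vecs I}"

definition nonneg_exps :: "'i set \<Rightarrow> ('i \<Rightarrow>\<^sub>0 int) set" where
  "nonneg_exps I = {a \<in> vecs I. \<forall>i. 0 \<le> Poly_Mapping.lookup a i}"

definition poly_ring :: "'i set \<Rightarrow> ('i, 'k::zero) laurent set" where
  "poly_ring I = {f. Poly_Mapping.keys f \<subseteq> nonneg_exps I}"

definition laurent_eval :: "('i, 'k::field) laurent \<Rightarrow> ('i \<Rightarrow> 'k) \<Rightarrow> 'k" where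
  "laurent_eval f z =
     (\<Sum>a\<in>Poly_Mapping.keys f. Poly_Mapping.lookup f a *
        (\<Prod>i\<in>Poly_Mapping.keys a. z i powi Poly_Mapping.lookup a i))"

text \<open>\<open>R\<close> is a subring of the ambient type, and the ideal is one of \<open>R\<close>.\<close>

definition ideal_gen :: "'r::comm_ring_1 set \<Rightarrow> 'r set \<Rightarrow> 'r set" where
  "ideal_gen R G = {\<Sum>g\<in>F. c g * g | F c. finite F \<and> F \<subseteq> G \<and> (\<forall>g\<in>F. c g \<in> R)}"

definition weight :: "('i \<Rightarrow> real) \<Rightarrow> ('i \<Rightarrow>\<^sub>0 int) \<Rightarrow> real" where
  "weight w a = (\<Sum>i\<in>Poly_Mapping.keys a. w i * of_int (Poly_Mapping.lookup a i))"

definition init_form :: "('i \<Rightarrow> real) \<Rightarrow> ('i, 'k::comm_ring_1) laurent \<Rightarrow> ('i, 'k) laurent" where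
  "init_form w f =
     (\<Sum>a | a \<in> Poly_Mapping.keys f \<and> (\<forall>b\<in>Poly_Mapping.keys f. weight w a \<le> weight w b).
        Poly_Mapping.single a (Poly_Mapping.lookup f a))"

definition init_ideal ::
    "'i set \<Rightarrow> ('i \<Rightarrow> real) \<Rightarrow> ('i, 'k::comm_ring_1) laurent set \<Rightarrow> ('i, 'k) laurent set" where
  "init_ideal I w J = ideal_gen (laurent_ring I) (init_form w ` J)"

definition real_vecs :: "'i set \<Rightarrow> ('i \<Rightarrow> real) set" where
  "real_vecs I = {w. \<forall>i. i \<notin> I \<longrightarrow> w i = 0}"

text \<open>
  A closed subvariety of the torus with coordinates \<open>I\<close> is given by its ideal \<open>J\<close> in the Laurent
  polynomial ring; in particular the hypersurface \<open>V(f)\<close> is given by the principal ideal \<open>(f)\<close>.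
  The intersection below is taken inside \<open>\<real>\<^sup>I\<close>, which matters when \<open>G\<close> is empty.
\<close>

definition trop :: "'i set \<Rightarrow> ('i, 'k::comm_ring_1) laurent set \<Rightarrow> ('i \<Rightarrow> real) set" where
  "trop I J = {w \<in> real_vecs I. \<forall>a\<in>vecs I. Poly_Mapping.single a 1 \<notin> init_ideal I w J}"

definition tropical_basis ::
    "'i set \<Rightarrow> ('i, 'k::comm_ring_1) laurent set \<Rightarrow> ('i, 'k) laurent set \<Rightarrow> bool" where
  "tropical_basis I J G \<longleftrightarrow>
     G \<subseteq> J \<and> trop I J = real_vecs I \<inter> (\<Inter>f\<in>G. trop I (ideal_gen (laurent_ring I) {f}))"


section \<open>The line\<close>

text \<open>
  A line in \<open>\<bbbP>\<^sup>m\<close>, as the set \<open>L\<close> of the homogeneous coordinate vectors \<open>y\<close> of its points together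
  with \<open>0\<close>, that is, a two-dimensional linear subspace of \<open>K\<^sup>m\<^sup>+\<^sup>1\<close>.
\<close>

definition projective_line :: "nat \<Rightarrow> (nat \<Rightarrow> 'k::field) set \<Rightarrow> bool" where
  "projective_line m L \<longleftrightarrow>
     (\<exists>p q. (\<forall>i>m. p i = 0 \<and> q i = 0) \<and>
            (\<forall>s t. (\<forall>i. s * p i + t * q i = 0) \<longrightarrow> s = 0 \<and> t = 0) \<and>
            L = {\<lambda>i. s * p i + t * q i | s t. True})"

definition line_torus :: "nat \<Rightarrow> (nat \<Rightarrow> 'k::field) set \<Rightarrow> (nat \<Rightarrow> 'k) set" where
  "line_torus m L = {\<lambda>i. y i / y 0 | y. y \<in> L \<and> (\<forall>i\<le>m. y i \<noteq> 0)}"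

definition line_ideal :: "nat \<Rightarrow> (nat \<Rightarrow> 'k::field) set \<Rightarrow> (nat, 'k) laurent set" where
  "line_ideal m L = {f \<in> laurent_ring {1..m}. \<forall>z\<in>line_torus m L. laurent_eval f z = 0}"

text \<open>The dehomogenization of the linear form \<open>c\<^sub>0 y\<^sub>0 + \<dots> + c\<^sub>m y\<^sub>m\<close>.\<close>

definition dehom_linear_form :: "nat \<Rightarrow> (nat \<Rightarrow> 'k::comm_ring_1) \<Rightarrow> (nat, 'k) laurent" where
  "dehom_linear_form m c =
     Poly_Mapping.single 0 (c 0) +
     (\<Sum>i\<in>{1..m}. Poly_Mapping.single (Poly_Mapping.single i 1) (c i))"


section \<open>The affine varieties\<close>

text \<open>
  The variables of \<open>S\<close> are the elements of \<open>H\<close> themselves.  The map \<open>monomial_degree\<close> sends an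
  exponent vector \<open>a\<close> to \<open>\<Sum>\<^sub>h a\<^sub>h h\<close>, so that \<open>x\<^sup>a\<close> has image \<open>\<chi>\<close> to the power \<open>monomial_degree a\<close>.
\<close>

definition monomial_degree :: "((zvec \<times> zvec) \<Rightarrow>\<^sub>0 int) \<Rightarrow> zvec \<times> zvec" where
  "monomial_degree a = (frag_extend fst a, frag_extend snd a)"

definition monoid_generators ::
    "nat \<Rightarrow> nat \<Rightarrow> qvec set \<Rightarrow> (nat \<Rightarrow> qvec set) \<Rightarrow> (zvec \<times> zvec) set \<Rightarrow> bool" where
  "monoid_generators d m \<sigma> \<Delta> H \<longleftrightarrow>
     monomial_degree ` nonneg_exps H = lattice_points d m (coneC_dual d m \<sigma> \<Delta>)"

definition algC ::
    "nat \<Rightarrow> nat \<Rightarrow> qvec set \<Rightarrow> (nat \<Rightarrow> qvec set) \<Rightarrow> ((zvec \<times> zvec) \<Rightarrow>\<^sub>0 'k::zero) set" where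
  "algC d m \<sigma> \<Delta> = {f. Poly_Mapping.keys f \<subseteq> lattice_points d m (coneC_dual d m \<sigma> \<Delta>)}"

definition to_algC :: "(zvec \<times> zvec, 'k::comm_ring_1) laurent \<Rightarrow> ((zvec \<times> zvec) \<Rightarrow>\<^sub>0 'k)" where
  "to_algC F = (\<Sum>a\<in>Poly_Mapping.keys F.
     Poly_Mapping.single (monomial_degree a) (Poly_Mapping.lookup F a))"

definition toric_ideal :: "(zvec \<times> zvec) set \<Rightarrow> (zvec \<times> zvec, 'k::comm_ring_1) laurent set" where
  "toric_ideal H = {F \<in> poly_ring H. to_algC F = 0}"

text \<open>The element \<open>f \<sqdot> \<chi>\<^sup>u\<close>, for \<open>f\<close> a Laurent polynomial in \<open>z\<^sub>1, \<dots>, z\<^sub>m\<close>.\<close>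

definition times_chi :: "(nat, 'k::comm_ring_1) laurent \<Rightarrow> zvec \<Rightarrow> ((zvec \<times> zvec) \<Rightarrow>\<^sub>0 'k)" where
  "times_chi f u =
     (\<Sum>v\<in>Poly_Mapping.keys f. Poly_Mapping.single (u, v) (Poly_Mapping.lookup f v))"

definition ideal_tilde ::
    "nat \<Rightarrow> nat \<Rightarrow> qvec set \<Rightarrow> (nat \<Rightarrow> qvec set) \<Rightarrow> (nat \<Rightarrow> 'k::field) set
      \<Rightarrow> ((zvec \<times> zvec) \<Rightarrow>\<^sub>0 'k) set" where
  "ideal_tilde d m \<sigma> \<Delta> L = ideal_gen (algC d m \<sigma> \<Delta>)
     {times_chi f u | f u. u \<in> vecs {1..d} \<and> f \<in> line_ideal m L \<and> times_chi f u \<in> algC d m \<sigma> \<Delta>}"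

text \<open>
  The map \<open>A(C) \<rightarrow> A(L)\<close>, \<open>z\<^sup>v \<chi>\<^sup>u \<mapsto> z\<^sup>v|\<^sub>L \<chi>\<^sup>u\<close>.  The divisors \<open>Q\<^sub>i\<close> are supported off \<open>L\<degree>\<close>, so all
  sections occurring in \<open>A(L)\<close> are regular functions on \<open>L\<degree>\<close> and are determined by their values
  there.  An element of \<open>A(L)\<close> is accordingly represented by the family, indexed by \<open>u\<close>, of
  the functions \<open>L\<degree> \<rightarrow> K\<close> multiplying \<open>\<chi>\<^sup>u\<close>, extended by \<open>0\<close> off \<open>L\<degree>\<close>.
\<close>

definition restrict_to_line ::
    "nat \<Rightarrow> (nat \<Rightarrow> 'k::field) set \<Rightarrow> ((zvec \<times> zvec) \<Rightarrow>\<^sub>0 'k) \<Rightarrow> zvec \<Rightarrow> (nat \<Rightarrow> 'k) \<Rightarrow> 'k" where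
  "restrict_to_line m L f u z =
     (if z \<in> line_torus m L then laurent_eval (Poly_Mapping.map_key (Pair u) f) z else 0)"

definition idealJ ::
    "nat \<Rightarrow> (zvec \<times> zvec) set \<Rightarrow> (nat \<Rightarrow> 'k::field) set \<Rightarrow> (zvec \<times> zvec, 'k) laurent set" where
  "idealJ m H L = {F \<in> poly_ring H. restrict_to_line m L (to_algC F) = (\<lambda>u z. 0)}"

text \<open>The ideal of the intersection of \<open>X(L)\<close> with the torus with coordinates \<open>H\<close>.\<close>

definition idealJ_torus ::
    "nat \<Rightarrow> (zvec \<times> zvec) set \<Rightarrow> (nat \<Rightarrow> 'k::field) set \<Rightarrow> (zvec \<times> zvec, 'k) laurent set" where
  "idealJ_torus m H L = ideal_gen (laurent_ring H) (idealJ m H L)"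


section \<open>Generators and lifts\<close>

text \<open>
  Both the generators of the toric ideal and the lifts have to be chosen suitably to obtain a
  tropical basis.  Replacing the toric generator \<open>x\<^sub>3\<^sub>h - x\<^sub>h\<^sup>3\<close> by its sum with another generator
  \<open>x\<^sub>2\<^sub>h - x\<^sub>h\<^sup>2\<close>, or adding to a lift an element of the toric ideal of lower weight, can strictly
  enlarge the intersection of the tropical hypersurfaces.  The usual choices are binomial
  generators and lifts taken monomial by monomial.
\<close>

definition tilde_generators ::
    "(nat, 'k::comm_ring_1) laurent set \<Rightarrow> (zvec \<times> zvec) set \<Rightarrow> ((zvec \<times> zvec) \<Rightarrow>\<^sub>0 'k) set" where
  "tilde_generators G Ps =
     {times_chi (g * Poly_Mapping.single v 1) u | g u v. g \<in> G \<and> (u, v) \<in> Ps}"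

definition binomials :: "(zvec \<times> zvec) set \<Rightarrow> (zvec \<times> zvec, 'k::comm_ring_1) laurent set" where
  "binomials H = {Poly_Mapping.single a 1 - Poly_Mapping.single b 1 | a b.
     a \<in> nonneg_exps H \<and> b \<in> nonneg_exps H}"

text \<open>A set consisting of lifts to \<open>S\<close> of elements of \<open>A\<close>, at least one for every element.\<close>

definition lifts ::
    "(zvec \<times> zvec) set \<Rightarrow> ((zvec \<times> zvec) \<Rightarrow>\<^sub>0 'k::comm_ring_1) set
      \<Rightarrow> (zvec \<times> zvec, 'k) laurent set \<Rightarrow> bool" where
  "lifts H A \<Lambda> \<longleftrightarrow> \<Lambda> \<subseteq> poly_ring H \<and> to_algC ` \<Lambda> = A"

text \<open>
  Distinct monomials of \<open>F\<close> have distinct images in \<open>A(C)\<close>: \<open>F\<close> arises from its image by replacing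
  every monomial \<open>\<chi>\<^sup>p\<close> by a single monomial \<open>x\<^sup>a\<close> of \<open>S\<close> mapping to it.
\<close>

definition termwise :: "(zvec \<times> zvec, 'k::comm_ring_1) laurent \<Rightarrow> bool" where
  "termwise F \<longleftrightarrow> inj_on monomial_degree (Poly_Mapping.keys F)"

end

theory Submission
  imports Defs
begin

text \<open>
  A line \<open>L\<close> meeting the torus is cut out by linear relations: one homogeneous
  coordinate \<open>y\<^sub>0\<close> and a second one \<open>y\<^sub>b\<close> are coordinates on \<open>L\<close>, and every other \<open>y\<^sub>i\<close> is a linear
  combination of these two.  A Laurent polynomial vanishing on \<open>L\<degree>\<close>, made homogeneous of degree
  \<open>0\<close>, can therefore be reduced to a binary form in \<open>y\<^sub>0, y\<^sub>b\<close> by subtracting multiples of the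
  relations, and a binary form with infinitely many zeros is zero.  In this reduction, no exponent
  drops below the minimum that it has in the given polynomial (\<open>line_ideal_induct\<close>).  The
  bounds on exponents that define the graded piece \<open>A(C)\<^sub>u\<close> are of exactly this kind, and the
  monomial factor of a relation has degree \<open>-1\<close>, which is the \<open>-1\<close> in the definition of \<open>P\<close>.  So
  the ideal of \<open>X(L)\<close> in \<open>A(C)\<close> is generated by products of linear relations with monomials
  \<open>z\<^sup>v \<chi>\<^sup>u\<close>, \<open>(u, v) \<in> P\<close>.

  It remains that the tropical basis \<open>\<G>\<close> spans all linear relations (\<open>rel_form_in_span\<close>).
  If it did not, its common zeros would contain a linear space of dimension three.  Such a space has
  a tropical point with three distinct homogeneous coordinates; a line has none, as any three
  coordinates satisfy a linear relation on it.

  A weight \<open>w\<close> lies outside the tropicalization of an ideal exactly when some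
  element has a single term of minimal weight (\<open>trop_iff\<close>).  Let \<open>w\<close> lie in the tropical
  hypersurfaces of all the listed elements.  The binomials force the weight of a monomial of \<open>S\<close>
  to depend on its image in \<open>A(C)\<close> only (\<open>weight_determined_by_degree\<close>), and the resulting weight
  on \<open>C\<^sup>\<or> \<inter> (M \<times> \<int>\<^sup>m)\<close> varies in the \<open>\<int>\<^sup>m\<close>-direction like one weight \<open>w'\<close> on \<open>\<int>\<^sup>m\<close>
  (\<open>induced_weight_difference\<close>).  An element of \<open>J(L)\<close> with a strictly minimal term for \<open>w\<close> then
  has a graded piece in \<open>I(L)\<close> with a strictly minimal term for \<open>w'\<close>; so does some \<open>g \<in> \<G>\<close>,
  \<open>\<G>\<close> being a tropical basis; and the term by term lift of \<open>g z\<^sup>v \<chi>\<^sup>u\<close> has one for \<open>w\<close>, which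
  contradicts the choice of \<open>w\<close> (\<open>tropical_basis_lifts\<close>).
\<close>


abbreviation "lookup \<equiv> Poly_Mapping.lookup"
abbreviation "keys \<equiv> Poly_Mapping.keys"
abbreviation "single \<equiv> Poly_Mapping.single"

section \<open>Linear extension and pushforward along maps of exponents\<close>

lemma sum_single_keys: "(\<Sum>a\<in>keys f. single a (lookup f a)) = f"
proof (rule poly_mapping_eqI)
  fix k
  show "lookup (\<Sum>a\<in>keys f. single a (lookup f a)) k = lookup f k"
    by (cases "k \<in> keys f")
      (auto simp: lookup_sum lookup_single when_def sum.delta in_keys_iff)
qed

lemma monomial_induct [consumes 1, case_names zero single add]:
  fixes f :: "'a \<Rightarrow>\<^sub>0 'b::comm_monoid_add"
  assumes "keys f \<subseteq> A" and zero: "P 0" and single: "\<And>a c. a \<in> A \<Longrightarrow> P (single a c)"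
    and add: "\<And>f g. P f \<Longrightarrow> P g \<Longrightarrow> P (f + g)"
  shows "P f"
proof -
  have "P (\<Sum>a\<in>B. single a (lookup f a))" if "finite B" "B \<subseteq> A" for B
    using that by (induction B) (auto intro!: zero add single)
  from this[of "keys f"] assms(1) show ?thesis by (simp add: sum_single_keys)
qed

text \<open>
  Evaluation at a point, reading off a coefficient of an image, and summing coefficients
  over a degree are all linear in the polynomial; treating them as one construction gives their behaviour under
  products with monomials at once.
\<close>

definition lin_ext :: "('a \<Rightarrow> 'b) \<Rightarrow> ('a \<Rightarrow>\<^sub>0 'b::comm_ring_1) \<Rightarrow> 'b" where
  "lin_ext h f = (\<Sum>a\<in>keys f. lookup f a * h a)"

lemma lin_ext_superset:
  assumes "finite A" "keys f \<subseteq> A"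
  shows "lin_ext h f = (\<Sum>a\<in>A. lookup f a * h a)"
  unfolding lin_ext_def using assms by (intro sum.mono_neutral_left) (auto simp: in_keys_iff)

lemma lin_ext_zero [simp]: "lin_ext h 0 = 0"
  by (simp add: lin_ext_def)

lemma lin_ext_single [simp]: "lin_ext h (single a c) = c * h a"
  by (auto simp: lin_ext_def)

lemma lin_ext_add: "lin_ext h (f + g) = lin_ext h f + lin_ext h g"
proof -
  have "lin_ext h x = (\<Sum>a\<in>keys f \<union> keys g. lookup x a * h a)"
    if "x = f \<or> x = g \<or> x = f + g" for x
    using that Poly_Mapping.keys_add[of f g] by (intro lin_ext_superset) auto
  then show ?thesis by (simp add: lookup_add algebra_simps sum.distrib)
qed

lemma lin_ext_uminus: "lin_ext h (- f) = - lin_ext h f"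
  using lin_ext_add[of h "- f" f] by (simp add: eq_neg_iff_add_eq_0)

lemma lin_ext_diff: "lin_ext h (f - g) = lin_ext h f - lin_ext h g"
  using lin_ext_add[of h f "- g"] by (simp add: lin_ext_uminus)

lemma lin_ext_sum: "lin_ext h (\<Sum>x\<in>A. f x) = (\<Sum>x\<in>A. lin_ext h (f x))"
  by (induction A rule: infinite_finite_induct) (auto simp: lin_ext_add)

lemma lin_ext_cong: "(\<And>a. a \<in> keys f \<Longrightarrow> h a = h' a) \<Longrightarrow> lin_ext h f = lin_ext h' f"
  by (simp add: lin_ext_def)

lemma lin_ext_scale: "lin_ext (\<lambda>a. c * h a) f = c * lin_ext h f"
  by (simp add: lin_ext_def sum_distrib_left mult.left_commute)

lemma lin_ext_single_mult:
  "lin_ext h (single b c * f) = c * lin_ext (\<lambda>a. h (b + a)) f"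
proof -
  have "keys f \<subseteq> UNIV" by simp
  then show ?thesis
    by (induction f rule: monomial_induct)
      (auto simp: lin_ext_add distrib_left Poly_Mapping.mult_single algebra_simps)
qed

text \<open>
  The maps \<open>x\<^sup>a \<mapsto> \<chi>\<^sup>d\<close>, with \<open>d\<close> the degree of \<open>a\<close>, from \<open>S\<close> to \<open>A(C)\<close>, and \<open>f \<mapsto> f \<sqdot> \<chi>\<^sup>u\<close>, and the
  choice of a monomial of \<open>S\<close> over each monomial of \<open>A(C)\<close> are all of this form.
\<close>

definition pushforward :: "('a \<Rightarrow> 'b) \<Rightarrow> ('a \<Rightarrow>\<^sub>0 'k::comm_ring_1) \<Rightarrow> ('b \<Rightarrow>\<^sub>0 'k)" where
  "pushforward \<phi> f = (\<Sum>a\<in>keys f. single (\<phi> a) (lookup f a))"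

lemma lookup_pushforward:
  "lookup (pushforward \<phi> f) b = lin_ext (\<lambda>a. of_bool (\<phi> a = b)) f"
  by (simp add: pushforward_def lin_ext_def lookup_sum lookup_single when_def of_bool_def if_distrib cong: if_cong)

lemma pushforward_zero [simp]: "pushforward \<phi> 0 = 0"
  by (simp add: pushforward_def)

lemma pushforward_single [simp]: "pushforward \<phi> (single a c) = single (\<phi> a) c"
  by (auto simp: pushforward_def)

lemma pushforward_add: "pushforward \<phi> (f + g) = pushforward \<phi> f + pushforward \<phi> g"
  by (rule poly_mapping_eqI) (simp add: lookup_pushforward lookup_add lin_ext_add)

lemma pushforward_diff: "pushforward \<phi> (f - g) = pushforward \<phi> f - pushforward \<phi> g"
  by (rule poly_mapping_eqI) (simp add: lookup_pushforward lookup_minus lin_ext_diff)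

lemma pushforward_sum: "pushforward \<phi> (\<Sum>x\<in>A. f x) = (\<Sum>x\<in>A. pushforward \<phi> (f x))"
  by (induction A rule: infinite_finite_induct) (auto simp: pushforward_add)

lemma keys_pushforward: "keys (pushforward \<phi> f) \<subseteq> \<phi> ` keys f"
  unfolding pushforward_def by (rule order.trans[OF keys_sum]) auto

lemma lin_ext_pushforward: "lin_ext h (pushforward \<phi> f) = lin_ext (\<lambda>a. h (\<phi> a)) f"
  unfolding pushforward_def by (simp add: lin_ext_sum) (simp add: lin_ext_def)

lemma pushforward_pushforward: "pushforward \<psi> (pushforward \<phi> f) = pushforward (\<lambda>a. \<psi> (\<phi> a)) f"
  by (rule poly_mapping_eqI) (simp add: lookup_pushforward lin_ext_pushforward)

lemma pushforward_ident: "(\<And>a. a \<in> keys f \<Longrightarrow> \<phi> a = a) \<Longrightarrow> pushforward \<phi> f = f"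
  by (simp add: pushforward_def sum_single_keys)

lemma lookup_pushforward_inj:
  assumes "inj_on \<phi> (insert a (keys f))"
  shows "lookup (pushforward \<phi> f) (\<phi> a) = lookup f a"
proof -
  have "lin_ext (\<lambda>b. of_bool (\<phi> b = \<phi> a)) f = lin_ext (\<lambda>b. of_bool (b = a)) f"
    using inj_onD[OF assms] by (intro lin_ext_cong) (auto simp: of_bool_def)
  also have "\<dots> = lookup f a"
    by (cases "a \<in> keys f") (auto simp: lin_ext_def in_keys_iff of_bool_def if_distrib sum.delta cong: if_cong)
  finally show ?thesis by (simp add: lookup_pushforward)
qed

lemma keys_pushforward_inj:
  assumes "inj_on \<phi> (keys f)"
  shows "keys (pushforward \<phi> f) = \<phi> ` keys f"
proof
  show "\<phi> ` keys f \<subseteq> keys (pushforward \<phi> f)"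
    using assms by (auto simp: in_keys_iff[of _ "pushforward \<phi> f"] lookup_pushforward_inj insert_absorb)
qed (rule keys_pushforward)

lemma pushforward_single_mult:
  assumes "\<And>a. \<phi> (b + a) = b' + \<phi>' a"
  shows "pushforward \<phi> (single b c * f) = single b' c * pushforward \<phi>' f"
proof -
  have "keys f \<subseteq> UNIV" by simp
  then show ?thesis
    by (induction f rule: monomial_induct)
      (auto simp: pushforward_add distrib_left Poly_Mapping.mult_single assms)
qed

lemma pushforward_mult:
  assumes "\<And>a b. \<phi> (a + b) = \<phi> a + \<phi> b"
  shows "pushforward \<phi> (f * g) = pushforward \<phi> f * pushforward \<phi> g"
proof -
  have "keys f \<subseteq> UNIV" by simp
  then show ?thesis
    by (induction f rule: monomial_induct)
      (auto simp: pushforward_add distrib_right pushforward_single_mult[where \<phi> = \<phi> and \<phi>' = \<phi>, OF assms])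
qed

lemma lookup_single_mult [simp]:
  fixes f :: "'a::ab_group_add \<Rightarrow>\<^sub>0 'k::comm_ring_1"
  shows "lookup (single b c * f) a = c * lookup f (a - b)"
proof -
  have "keys f \<subseteq> UNIV" by simp
  then show ?thesis
    by (induction f rule: monomial_induct)
      (auto simp: lookup_add distrib_left Poly_Mapping.mult_single lookup_single when_def algebra_simps)
qed


section \<open>Monoid algebras and their ideals\<close>

definition supported :: "'a set \<Rightarrow> ('a \<Rightarrow>\<^sub>0 'b::zero) set" where
  "supported A = {f. keys f \<subseteq> A}"

definition submonoid :: "'a::monoid_add set \<Rightarrow> bool" where
  "submonoid A \<longleftrightarrow> 0 \<in> A \<and> (\<forall>a\<in>A. \<forall>b\<in>A. a + b \<in> A)"

definition is_ideal :: "'r::comm_ring_1 set \<Rightarrow> 'r set \<Rightarrow> bool" where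
  "is_ideal R J \<longleftrightarrow> 0 \<in> J \<and> (\<forall>x\<in>J. \<forall>y\<in>J. x + y \<in> J) \<and> (\<forall>r\<in>R. \<forall>x\<in>J. r * x \<in> J)"

lemma is_idealD:
  assumes "is_ideal R J"
  shows "0 \<in> J" "x \<in> J \<Longrightarrow> y \<in> J \<Longrightarrow> x + y \<in> J" "r \<in> R \<Longrightarrow> x \<in> J \<Longrightarrow> r * x \<in> J"
  using assms by (auto simp: is_ideal_def)

lemma is_ideal_sum:
  assumes "is_ideal R J" "\<And>x. x \<in> A \<Longrightarrow> f x \<in> J"
  shows "(\<Sum>x\<in>A. f x) \<in> J"
  using assms(2) by (induction A rule: infinite_finite_induct) (auto intro!: is_idealD[OF assms(1)])

lemma supported_zero [simp]: "0 \<in> supported A"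
  and supported_single: "a \<in> A \<Longrightarrow> single a c \<in> supported A"
  by (auto simp: supported_def)

lemma supported_add: "f \<in> supported A \<Longrightarrow> g \<in> supported A \<Longrightarrow> f + g \<in> supported A"
  using Poly_Mapping.keys_add[of f g] by (auto simp: supported_def)

lemma supported_diff: "f \<in> supported A \<Longrightarrow> g \<in> supported A \<Longrightarrow> f - g \<in> supported A"
  for f :: "'a \<Rightarrow>\<^sub>0 'b::ab_group_add"
  by (auto simp: supported_def in_keys_iff lookup_minus subset_eq)

lemma supported_mult:
  assumes "submonoid A" "f \<in> supported A" "g \<in> supported A"
  shows "f * g \<in> supported A"
  unfolding supported_def
proof safe
  fix k assume "k \<in> keys (f * g)"
  then obtain a b where "k = a + b" "a \<in> keys f" "b \<in> keys g"
    using keys_mult[of f g] by blast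
  then show "k \<in> A"
    using assms unfolding supported_def submonoid_def by blast
qed

lemma supported_one: "submonoid A \<Longrightarrow> 1 \<in> supported A"
  by (auto simp: supported_def submonoid_def)

text \<open>Over a monoid algebra, stability under multiplication by monomials is enough.\<close>

lemma is_idealI:
  fixes J :: "('a::comm_monoid_add \<Rightarrow>\<^sub>0 'b::comm_ring_1) set"
  assumes "0 \<in> J" "\<And>x y. x \<in> J \<Longrightarrow> y \<in> J \<Longrightarrow> x + y \<in> J"
    and "\<And>a c x. a \<in> A \<Longrightarrow> x \<in> J \<Longrightarrow> single a c * x \<in> J"
  shows "is_ideal (supported A) J"
proof -
  have "r * x \<in> J" if "keys r \<subseteq> A" "x \<in> J" for r x :: "'a \<Rightarrow>\<^sub>0 'b"
    using that by (induction r rule: monomial_induct) (auto simp: distrib_right intro: assms)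
  then show ?thesis using assms by (auto simp: is_ideal_def supported_def)
qed

lemma supported_is_ideal: "submonoid A \<Longrightarrow> is_ideal (supported A) (supported A)"
  by (auto simp: is_ideal_def intro: supported_add supported_mult)

lemma ideal_gen_least:
  assumes "is_ideal R J" "G \<subseteq> J"
  shows "ideal_gen R G \<subseteq> J"
  using assms by (auto simp: ideal_gen_def intro!: is_ideal_sum[OF assms(1)] is_idealD(3)[OF assms(1)])

lemma ideal_genI:
  assumes "x = (\<Sum>g\<in>F. c g * g)" "finite F" "F \<subseteq> G" "\<forall>g\<in>F. c g \<in> R"
  shows "x \<in> ideal_gen R G"
  unfolding ideal_gen_def mem_Collect_eq using assms by blast

lemma ideal_gen_is_ideal:
  fixes G :: "('a::comm_monoid_add \<Rightarrow>\<^sub>0 'b::comm_ring_1) set"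
  assumes "submonoid A"
  shows "is_ideal (supported A) (ideal_gen (supported A) G)"
  unfolding is_ideal_def
proof (intro conjI ballI)
  show "0 \<in> ideal_gen (supported A) G"
    by (auto simp: ideal_gen_def intro!: exI[of _ "{}"])
  fix x assume "x \<in> ideal_gen (supported A) G"
  then obtain F c where x: "x = (\<Sum>g\<in>F. c g * g)" "finite F" "F \<subseteq> G" "\<forall>g\<in>F. c g \<in> supported A"
    by (auto simp: ideal_gen_def)
  { fix y assume "y \<in> ideal_gen (supported A) G"
    then obtain F' c' where y: "y = (\<Sum>g\<in>F'. c' g * g)" "finite F'" "F' \<subseteq> G" "\<forall>g\<in>F'. c' g \<in> supported A"
      by (auto simp: ideal_gen_def)
    define e where "e g = (if g \<in> F then c g else 0) + (if g \<in> F' then c' g else 0)" for g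
    have "x = (\<Sum>g\<in>F \<union> F'. (if g \<in> F then c g else 0) * g)"
      unfolding x using x(2) y(2) by (intro sum.mono_neutral_cong_left) auto
    moreover have "y = (\<Sum>g\<in>F \<union> F'. (if g \<in> F' then c' g else 0) * g)"
      unfolding y using x(2) y(2) by (intro sum.mono_neutral_cong_left) auto
    ultimately have "x + y = (\<Sum>g\<in>F \<union> F'. e g * g)"
      by (simp add: e_def distrib_right sum.distrib)
    moreover have "\<forall>g\<in>F \<union> F'. e g \<in> supported A"
      using x y by (auto simp: e_def intro!: supported_add)
    ultimately show "x + y \<in> ideal_gen (supported A) G"
      using x(2,3) y(2,3) by (intro ideal_genI[of _ e "F \<union> F'"]) auto }
  fix r :: "'a \<Rightarrow>\<^sub>0 'b" assume r: "r \<in> supported A"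
  have "r * x = (\<Sum>g\<in>F. (r * c g) * g)"
    by (simp add: x sum_distrib_left mult.assoc)
  moreover have "\<forall>g\<in>F. r * c g \<in> supported A"
    using x(4) r by (auto intro: supported_mult[OF assms])
  ultimately show "r * x \<in> ideal_gen (supported A) G"
    using x(2,3) by (intro ideal_genI[of _ "\<lambda>g. r * c g" F]) auto
qed

lemma ideal_gen_superset:
  assumes "submonoid A"
  shows "G \<subseteq> ideal_gen (supported A) G"
proof
  fix g assume "g \<in> G"
  then show "g \<in> ideal_gen (supported A) G"
    by (auto simp: ideal_gen_def intro!: exI[of _ "{g}"] exI[of _ "\<lambda>_. 1"] supported_one[OF assms])
qed

lemma laurent_ring_eq: "laurent_ring I = supported (vecs I)"
  and poly_ring_eq: "poly_ring I = supported (nonneg_exps I)"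
  and algC_eq: "algC d m \<sigma> \<Delta> = supported (lattice_points d m (coneC_dual d m \<sigma> \<Delta>))"
  by (auto simp: laurent_ring_def poly_ring_def algC_def supported_def)

lemma vecs_zero [simp]: "0 \<in> vecs I"
  by (auto simp: vecs_def)

lemma vecs_add: "a \<in> vecs I \<Longrightarrow> b \<in> vecs I \<Longrightarrow> a + b \<in> vecs I"
  using Poly_Mapping.keys_add[of a b] by (auto simp: vecs_def)

lemma vecs_diff: "a \<in> vecs I \<Longrightarrow> b \<in> vecs I \<Longrightarrow> a - b \<in> vecs I" for a b :: "'i \<Rightarrow>\<^sub>0 int"
  using keys_diff[of a b] by (auto simp: vecs_def)

lemma vecs_single: "i \<in> I \<Longrightarrow> single i c \<in> vecs I"
  by (auto simp: vecs_def)

lemma submonoid_vecs: "submonoid (vecs I :: ('i \<Rightarrow>\<^sub>0 'b::monoid_add) set)"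
proof -
  have "a + b \<in> vecs I" if "a \<in> vecs I" "b \<in> vecs I" for a b :: "'i \<Rightarrow>\<^sub>0 'b"
    using that by (force simp: vecs_def in_keys_iff lookup_add subset_eq)
  then show ?thesis by (auto simp: submonoid_def)
qed

lemma submonoid_nonneg: "submonoid (nonneg_exps I)"
  by (auto simp: submonoid_def nonneg_exps_def lookup_add vecs_add)


section \<open>Strictly minimal terms and tropical hypersurfaces\<close>

lemma weight_superset:
  assumes "finite A" "keys a \<subseteq> A"
  shows "weight w a = (\<Sum>i\<in>A. w i * of_int (lookup a i))"
  unfolding weight_def using assms by (intro sum.mono_neutral_left) (auto simp: in_keys_iff)

lemma weight_add: "weight w (a + b) = weight w a + weight w b"
proof -
  have "weight w x = (\<Sum>i\<in>keys a \<union> keys b. w i * of_int (lookup x i))"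
    if "x = a \<or> x = b \<or> x = a + b" for x
    using that Poly_Mapping.keys_add[of a b] by (intro weight_superset) auto
  then show ?thesis by (simp add: lookup_add algebra_simps sum.distrib)
qed

lemma weight_zero [simp]: "weight w 0 = 0"
  by (simp add: weight_def)

lemma weight_diff: "weight w (a - b) = weight w a - weight w b"
  using weight_add[of w "a - b" b] by simp

lemma weight_single [simp]: "weight w (single i c) = w i * of_int c"
  by (auto simp: weight_def)

text \<open>
  Over a field, this says that the initial form of \<open>f\<close> is a nonzero multiple of the monomial with exponent \<open>a\<close>.
\<close>

definition unique_min :: "('i \<Rightarrow> real) \<Rightarrow> ('i, 'k::zero) laurent \<Rightarrow> ('i \<Rightarrow>\<^sub>0 int) \<Rightarrow> bool" where
  "unique_min w f a \<longleftrightarrow> a \<in> keys f \<and> (\<forall>b\<in>keys f. b \<noteq> a \<longrightarrow> weight w a < weight w b)"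

lemma lookup_init_form:
  "lookup (init_form w f) a = (if \<forall>b\<in>keys f. weight w a \<le> weight w b then lookup f a else 0)"
proof -
  let ?A = "{a \<in> keys f. \<forall>b\<in>keys f. weight w a \<le> weight w b}"
  have "lookup (init_form w f) a = (\<Sum>b\<in>?A. if b = a then lookup f a else 0)"
    unfolding init_form_def lookup_sum by (intro sum.cong) (auto simp: lookup_single when_def)
  also have "\<dots> = (if a \<in> ?A then lookup f a else 0)"
    by (simp add: sum.delta)
  finally show ?thesis by (auto simp: in_keys_iff)
qed

text \<open>
  The elements all of whose weight components are initial parts of members of \<open>J\<close> form an ideal:
  two initial parts of the same weight add up to an initial part or cancel.  This turns a
  monomial that is merely a combination of initial forms into the initial form of one element.
\<close>

lemma init_ideal_unique_min:
  assumes J: "is_ideal (supported (vecs I)) J" and a: "single a 1 \<in> init_ideal I w J"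
  shows "\<exists>f\<in>J. unique_min w f a"
proof -
  define N where "N = {g. \<forall>s. \<exists>f\<in>J. (\<forall>b\<in>keys f. s \<le> weight w b) \<and>
      (\<forall>b. weight w b = s \<longrightarrow> lookup f b = lookup g b)}"
  have "is_ideal (supported (vecs I)) N"
  proof (rule is_idealI)
    show "0 \<in> N" using is_idealD(1)[OF J] by (auto simp: N_def intro!: bexI[of _ 0])
  next
    fix x y assume x: "x \<in> N" and y: "y \<in> N"
    show "x + y \<in> N" unfolding N_def
    proof (safe)
      fix s
      obtain f where f: "f \<in> J" "\<forall>b\<in>keys f. s \<le> weight w b" "\<forall>b. weight w b = s \<longrightarrow> lookup f b = lookup x b"
        using x unfolding N_def by blast
      obtain g where g: "g \<in> J" "\<forall>b\<in>keys g. s \<le> weight w b" "\<forall>b. weight w b = s \<longrightarrow> lookup g b = lookup y b"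
        using y unfolding N_def by blast
      show "\<exists>f\<in>J. (\<forall>b\<in>keys f. s \<le> weight w b) \<and> (\<forall>b. weight w b = s \<longrightarrow> lookup f b = lookup (x + y) b)"
        using f g Poly_Mapping.keys_add[of f g]
        by (intro bexI[of _ "f + g"]) (auto simp: lookup_add intro: is_idealD(2)[OF J])
    qed
  next
    fix e :: "'a \<Rightarrow>\<^sub>0 int" and c x assume e: "e \<in> vecs I" and x: "x \<in> N"
    show "single e c * x \<in> N" unfolding N_def
    proof (safe)
      fix s
      obtain f where f: "f \<in> J" "\<forall>b\<in>keys f. s - weight w e \<le> weight w b"
          "\<forall>b. weight w b = s - weight w e \<longrightarrow> lookup f b = lookup x b"
        using x unfolding N_def by blast
      show "\<exists>f\<in>J. (\<forall>b\<in>keys f. s \<le> weight w b) \<and>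
          (\<forall>b. weight w b = s \<longrightarrow> lookup f b = lookup (single e c * x) b)"
      proof (intro bexI[of _ "single e c * f"] conjI ballI allI impI)
        fix b assume "b \<in> keys (single e c * f)"
        then have "b - e \<in> keys f" by (auto simp: in_keys_iff)
        then have "s - weight w e \<le> weight w (b - e)" using f(2) by blast
        then show "s \<le> weight w b" by (simp add: weight_diff)
      next
        show "single e c * f \<in> J" by (rule is_idealD(3)[OF J]) (auto simp: e f supported_single)
      qed (use f(3) in \<open>auto simp: weight_diff\<close>)
    qed
  qed
  moreover have "init_form w ` J \<subseteq> N"
  proof
    fix g assume "g \<in> init_form w ` J"
    then obtain f where f: "f \<in> J" "g = init_form w f" by auto
    show "g \<in> N" unfolding N_def
    proof safe
      fix s
      show "\<exists>f\<in>J. (\<forall>b\<in>keys f. s \<le> weight w b) \<and> (\<forall>b. weight w b = s \<longrightarrow> lookup f b = lookup g b)"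
      proof (cases "\<exists>a\<in>keys f. weight w a = s \<and> (\<forall>b\<in>keys f. s \<le> weight w b)")
        case True
        then show ?thesis using f by (intro bexI[of _ f]) (auto simp: lookup_init_form)
      next
        case False
        then have "lookup g b = 0" if "weight w b = s" for b
          using that f(2) by (auto simp: lookup_init_form in_keys_iff)
        then show ?thesis using is_idealD(1)[OF J] by (intro bexI[of _ 0]) auto
      qed
    qed
  qed
  ultimately have "init_ideal I w J \<subseteq> N"
    unfolding init_ideal_def laurent_ring_eq by (rule ideal_gen_least)
  with a have "single a 1 \<in> N" by auto
  then obtain f where f: "f \<in> J" "\<forall>b\<in>keys f. weight w a \<le> weight w b"
      "\<forall>b. weight w b = weight w a \<longrightarrow> lookup f b = lookup (single a 1) b"
    unfolding N_def by blast
  have "weight w a < weight w b" if b: "b \<in> keys f" "b \<noteq> a" for b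
  proof -
    have "weight w b \<noteq> weight w a" using b f(3) by (auto simp: lookup_single when_def in_keys_iff)
    then show ?thesis using f(2) b by force
  qed
  then have "unique_min w f a" using f by (auto simp: unique_min_def in_keys_iff)
  with f(1) show ?thesis by blast
qed

lemma unique_min_init_ideal:
  fixes f :: "('i, 'k::field) laurent"
  assumes "f \<in> J" "unique_min w f a"
  shows "single a 1 \<in> init_ideal I w J"
proof -
  have fa: "lookup f a \<noteq> 0" using assms(2) by (auto simp: unique_min_def in_keys_iff)
  have "init_form w f = single a (lookup f a)"
    using assms(2) by (intro poly_mapping_eqI)
      (force simp: lookup_init_form lookup_single when_def unique_min_def in_keys_iff)
  then have "single a 1 = single 0 (inverse (lookup f a)) * init_form w f"
    using fa by (simp add: Poly_Mapping.mult_single)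
  also have "\<dots> \<in> init_ideal I w J"
    unfolding init_ideal_def laurent_ring_eq
    using ideal_gen_superset[OF submonoid_vecs, of "init_form w ` J" I] assms(1)
    by (intro is_idealD(3)[OF ideal_gen_is_ideal[OF submonoid_vecs]] supported_single) auto
  finally show ?thesis .
qed

text \<open>
  Absence of monomials in the initial ideal is a condition on single elements of \<open>J\<close>, so that no
  initial ideals occur from here on.
\<close>

lemma trop_iff:
  fixes J :: "('i, 'k::field) laurent set"
  assumes J: "is_ideal (laurent_ring I) J" "J \<subseteq> laurent_ring I"
  shows "w \<in> trop I J \<longleftrightarrow> w \<in> real_vecs I \<and> (\<forall>f\<in>J. \<forall>a. \<not> unique_min w f a)"
proof -
  have "a \<in> vecs I" if "f \<in> J" "unique_min w f a" for f a
    using that J(2) by (auto simp: unique_min_def laurent_ring_def)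
  then show ?thesis
    using init_ideal_unique_min[OF J(1)[unfolded laurent_ring_eq]] unique_min_init_ideal[of _ J w _ I]
    unfolding trop_def mem_Collect_eq by blast
qed

lemma laurent_is_ideal: "is_ideal (laurent_ring I) (ideal_gen (laurent_ring I) G)"
  unfolding laurent_ring_eq by (rule ideal_gen_is_ideal[OF submonoid_vecs])

lemma laurent_ideal_gen_subset: "G \<subseteq> laurent_ring I \<Longrightarrow> ideal_gen (laurent_ring I) G \<subseteq> laurent_ring I"
  using supported_is_ideal[OF submonoid_vecs] by (auto simp: laurent_ring_eq dest: ideal_gen_least)

lemma trop_hypersurface_imp:
  fixes f :: "('i, 'k::field) laurent"
  assumes "f \<in> laurent_ring I" "w \<in> trop I (ideal_gen (laurent_ring I) {f})"
  shows "\<not> unique_min w f a"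
  using assms trop_iff[OF laurent_is_ideal laurent_ideal_gen_subset, of "{f}" I w]
    ideal_gen_superset[OF submonoid_vecs, of "{f}" I]
  by (auto simp: laurent_ring_eq)

lemma tropical_basis_iff:
  fixes J :: "('i, 'k::field) laurent set"
  assumes J: "is_ideal (laurent_ring I) J" "J \<subseteq> laurent_ring I" and G: "G \<subseteq> J"
  shows "tropical_basis I J G \<longleftrightarrow>
    (\<forall>w\<in>real_vecs I. (\<forall>f\<in>G. w \<in> trop I (ideal_gen (laurent_ring I) {f})) \<longrightarrow>
       (\<forall>f\<in>J. \<forall>a. \<not> unique_min w f a))"
proof -
  have "trop I J \<subseteq> trop I (ideal_gen (laurent_ring I) {f})" if "f \<in> G" for f
  proof -
    have "ideal_gen (laurent_ring I) {f} \<subseteq> J"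
      using that G by (intro ideal_gen_least J) auto
    moreover have "{f} \<subseteq> laurent_ring I" using that J(2) G by auto
    ultimately show ?thesis
      by (intro subsetI) (simp add: trop_iff[OF J] trop_iff[OF laurent_is_ideal laurent_ideal_gen_subset] subset_eq)
  qed
  then have "trop I J \<subseteq> real_vecs I \<inter> (\<Inter>f\<in>G. trop I (ideal_gen (laurent_ring I) {f}))"
    by (intro Int_greatest INT_greatest) (auto simp: trop_def)
  then have "tropical_basis I J G \<longleftrightarrow>
      real_vecs I \<inter> (\<Inter>f\<in>G. trop I (ideal_gen (laurent_ring I) {f})) \<subseteq> trop I J"
    using G unfolding tropical_basis_def by (metis order_antisym order_refl)
  also have "\<dots> \<longleftrightarrow>
      (\<forall>w\<in>real_vecs I. (\<forall>f\<in>G. w \<in> trop I (ideal_gen (laurent_ring I) {f})) \<longrightarrow> w \<in> trop I J)"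
    unfolding subset_eq Ball_def Int_iff INT_iff by blast
  also have "\<dots> \<longleftrightarrow> (\<forall>w\<in>real_vecs I. (\<forall>f\<in>G. w \<in> trop I (ideal_gen (laurent_ring I) {f})) \<longrightarrow>
       (\<forall>f\<in>J. \<forall>a. \<not> unique_min w f a))"
    by (simp add: trop_iff[OF J] cong: ball_cong)
  finally show ?thesis .
qed

lemma lookup_mult_unique:
  assumes "a \<in> keys f" "b \<in> keys g"
    and "\<And>a' b'. a' \<in> keys f \<Longrightarrow> b' \<in> keys g \<Longrightarrow> a' + b' = a + b \<Longrightarrow> a' = a \<and> b' = b"
  shows "lookup (f * g) (a + b) = lookup f a * lookup g b"
proof -
  have "f * g = (\<Sum>a'\<in>keys f. single a' (lookup f a')) * (\<Sum>b'\<in>keys g. single b' (lookup g b'))"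
    by (simp add: sum_single_keys)
  also have "\<dots> = (\<Sum>a'\<in>keys f. \<Sum>b'\<in>keys g. single (a' + b') (lookup f a' * lookup g b'))"
    by (simp add: sum_product Poly_Mapping.mult_single)
  finally have "lookup (f * g) (a + b) =
      (\<Sum>a'\<in>keys f. \<Sum>b'\<in>keys g. if a' + b' = a + b then lookup f a' * lookup g b' else 0)"
    by (simp add: lookup_sum lookup_single when_def)
  also have "\<dots> = (\<Sum>a'\<in>keys f. \<Sum>b'\<in>keys g. if b' = b then if a' = a then lookup f a * lookup g b else 0 else 0)"
    using assms(3) by (intro sum.cong refl) auto
  also have "\<dots> = lookup f a * lookup g b"
    using assms(1,2) by (simp add: sum.delta)
  finally show ?thesis .
qed

lemma finite_weight_min:
  assumes "f \<noteq> 0"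
  obtains \<mu> where "\<And>b. b \<in> keys f \<Longrightarrow> \<mu> \<le> weight w b" "{a \<in> keys f. weight w a = \<mu>} \<noteq> {}"
proof
  have "keys f \<noteq> {}" using assms by (metis keys_eq_empty)
  then have "Min (weight w ` keys f) \<in> weight w ` keys f" by (intro Min_in) auto
  then show "{a \<in> keys f. weight w a = Min (weight w ` keys f)} \<noteq> {}" by auto
qed auto

text \<open>
  Among the terms of minimal weight of each factor take the smallest exponents in a
  translation-invariant total order, and then the largest ones: the corresponding terms of the
  product do not cancel.  So a product with a strictly minimal term has factors with one.
\<close>

lemma unique_min_factor:
  fixes f h :: "('i::linorder, 'k::field) laurent"
  assumes "unique_min w (h * f) e"
  shows "\<exists>a. unique_min w f a"
proof (rule ccontr)
  assume no_min: "\<nexists>a. unique_min w f a"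
  have "h * f \<noteq> 0" using assms by (auto simp: unique_min_def)
  then have "h \<noteq> 0" "f \<noteq> 0" by auto
  obtain \<mu> where \<mu>: "\<And>b. b \<in> keys f \<Longrightarrow> \<mu> \<le> weight w b" "{a \<in> keys f. weight w a = \<mu>} \<noteq> {}"
    using finite_weight_min[OF \<open>f \<noteq> 0\<close>] by metis
  obtain \<nu> where \<nu>: "\<And>b. b \<in> keys h \<Longrightarrow> \<nu> \<le> weight w b" "{a \<in> keys h. weight w a = \<nu>} \<noteq> {}"
    using finite_weight_min[OF \<open>h \<noteq> 0\<close>] by metis
  define A where "A = {a \<in> keys f. weight w a = \<mu>}"
  define B where "B = {a \<in> keys h. weight w a = \<nu>}"
  have A: "finite A" "A \<noteq> {}" and B: "finite B" "B \<noteq> {}"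
    using \<mu> \<nu> by (auto simp: A_def B_def)
  have in_AB: "b \<in> B \<and> a \<in> A" if "b \<in> keys h" "a \<in> keys f" "weight w (b + a) = \<nu> + \<mu>" for a b
    using \<mu>(1)[OF that(2)] \<nu>(1)[OF that(1)] that by (auto simp: A_def B_def weight_add)
  have prod_key: "b + a \<in> keys (h * f)"
    if "b \<in> B" "a \<in> A" "\<And>b' a'. b' \<in> B \<Longrightarrow> a' \<in> A \<Longrightarrow> b' + a' = b + a \<Longrightarrow> b' = b \<and> a' = a" for a b
  proof -
    have "lookup (h * f) (b + a) = lookup h b * lookup f a"
    proof (rule lookup_mult_unique)
      fix b' a' assume *: "b' \<in> keys h" "a' \<in> keys f" "b' + a' = b + a"
      have "weight w (b + a) = \<nu> + \<mu>" using that(1,2) by (simp add: A_def B_def weight_add)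
      with * in_AB[of b' a'] have "b' \<in> B" "a' \<in> A" by simp_all
      then show "b' = b \<and> a' = a" using that(3) *(3) by blast
    qed (use that in \<open>auto simp: A_def B_def\<close>)
    then show ?thesis using that(1,2) by (auto simp: A_def B_def in_keys_iff)
  qed
  have only_e: "b + a = e" if "b \<in> B" "a \<in> A" "b + a \<in> keys (h * f)" for a b
  proof (rule ccontr)
    assume "b + a \<noteq> e"
    then have "weight w e < weight w (b + a)" using assms that(3) by (auto simp: unique_min_def)
    also have "\<dots> = \<nu> + \<mu>" using that(1,2) by (simp add: A_def B_def weight_add)
    finally have less: "weight w e < \<nu> + \<mu>" .
    have "e \<in> keys (h * f)" using assms by (simp add: unique_min_def)
    then obtain b' a' where "e = b' + a'" "b' \<in> keys h" "a' \<in> keys f"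
      using keys_mult[of h f] by blast
    with less \<mu>(1)[of a'] \<nu>(1)[of b'] show False by (auto simp: weight_add)
  qed
  \<comment> \<open>Both extreme products survive, so \<open>A\<close> must be a singleton.\<close>
  have "Min A \<in> A" "Max A \<in> A" "Min B \<in> B" "Max B \<in> B" using A B by auto
  have "Min B + Min A \<in> keys (h * f)"
  proof (rule prod_key)
    fix b' a' assume *: "b' \<in> B" "a' \<in> A" "b' + a' = Min B + Min A"
    then have "Min B \<le> b'" "Min A \<le> a'" using A B by auto
    with *(3) show "b' = Min B \<and> a' = Min A"
      by (metis add_less_le_mono add_le_less_mono order_less_irrefl order_le_less)
  qed fact+
  moreover have "Max B + Max A \<in> keys (h * f)"
  proof (rule prod_key)
    fix b' a' assume *: "b' \<in> B" "a' \<in> A" "b' + a' = Max B + Max A"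
    then have "b' \<le> Max B" "a' \<le> Max A" using A B by auto
    with *(3) show "b' = Max B \<and> a' = Max A"
      by (metis add_less_le_mono add_le_less_mono order_less_irrefl order_le_less)
  qed fact+
  ultimately have eq: "Min B + Min A = Max B + Max A"
    using only_e \<open>Min A \<in> A\<close> \<open>Max A \<in> A\<close> \<open>Min B \<in> B\<close> \<open>Max B \<in> B\<close> by metis
  have "Min B \<le> Max B" "Min A \<le> Max A" using A B by auto
  then have "Min A = Max A"
    using eq by (metis add_less_le_mono add_le_less_mono order_less_irrefl order_le_less)
  then have "a = Min A" if "a \<in> A" for a
    using that A by (metis Max_ge Min_le order_antisym)
  then have "b = Min A" if "b \<in> keys f" "weight w b \<le> \<mu>" for b
    using that \<mu>(1)[of b] unfolding A_def by (metis (mono_tags, lifting) mem_Collect_eq order_antisym)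
  moreover have "Min A \<in> keys f" "weight w (Min A) = \<mu>"
    using \<open>Min A \<in> A\<close> A_def by blast+
  ultimately have "unique_min w f (Min A)"
    unfolding unique_min_def by (metis linorder_not_le)
  with no_min show False by blast
qed

lemma trop_hypersurface_iff:
  fixes f :: "('i::linorder, 'k::field) laurent"
  assumes f: "f \<in> laurent_ring I"
  shows "w \<in> trop I (ideal_gen (laurent_ring I) {f}) \<longleftrightarrow> w \<in> real_vecs I \<and> (\<forall>a. \<not> unique_min w f a)"
proof -
  have "\<exists>a. unique_min w f a" if g: "g \<in> ideal_gen (laurent_ring I) {f}" "unique_min w g e" for g e
  proof -
    obtain F c where F: "g = (\<Sum>x\<in>F. c x * x)" "F \<subseteq> {f}"
      using g(1) unfolding ideal_gen_def mem_Collect_eq by blast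
    have "g \<noteq> 0" using g(2) by (auto simp: unique_min_def)
    then have "F = {f}" using F by (metis subset_singletonD sum.empty)
    then have "g = c f * f" using F by simp
    then show ?thesis using g(2) unique_min_factor by blast
  qed
  then show ?thesis
    using f trop_iff[OF laurent_is_ideal laurent_ideal_gen_subset, of "{f}" I w]
      trop_hypersurface_imp[OF f, of w]
    by auto
qed


section \<open>A line meeting the torus\<close>

definition mon :: "('i \<Rightarrow> 'k::field) \<Rightarrow> ('i \<Rightarrow>\<^sub>0 int) \<Rightarrow> 'k" where
  "mon z v = (\<Prod>i\<in>keys v. z i powi lookup v i)"

lemma laurent_eval_eq: "laurent_eval f z = lin_ext (mon z) f"
  by (simp add: laurent_eval_def lin_ext_def mon_def)

lemma mon_superset:
  assumes "finite A" "keys v \<subseteq> A"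
  shows "mon z v = (\<Prod>i\<in>A. z i powi lookup v i)"
  unfolding mon_def using assms by (intro prod.mono_neutral_left) (auto simp: in_keys_iff)

lemma mon_add:
  assumes "\<And>i. i \<in> I \<Longrightarrow> z i \<noteq> 0" "u \<in> vecs I" "v \<in> vecs I"
  shows "mon z (u + v) = mon z u * mon z v"
proof -
  let ?A = "keys u \<union> keys v"
  have "?A \<subseteq> I" using assms by (auto simp: vecs_def)
  have "mon z (u + v) = (\<Prod>i\<in>?A. z i powi (lookup u i + lookup v i))"
    using Poly_Mapping.keys_add[of u v] by (subst mon_superset[of ?A]) (auto simp: lookup_add)
  also have "\<dots> = (\<Prod>i\<in>?A. z i powi lookup u i * z i powi lookup v i)"
    using assms(1) \<open>?A \<subseteq> I\<close> by (intro prod.cong refl power_int_add) auto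
  also have "\<dots> = mon z u * mon z v"
    by (simp add: prod.distrib mon_superset[of ?A])
  finally show ?thesis .
qed

text \<open>
  The exponent of \<open>y\<^sub>i / y\<^sub>0\<close>, so that the constant term of a dehomogenized form is not a special case.
\<close>

definition var_exp :: "nat \<Rightarrow> zvec" where
  "var_exp i = (if i = 0 then 0 else single i 1)"

lemma var_exp_inj: "var_exp i = var_exp j \<longleftrightarrow> i = j"
proof
  assume *: "var_exp i = var_exp j"
  show "i = j"
  proof (rule ccontr)
    assume "i \<noteq> j"
    then have "lookup (var_exp i) (max i j) \<noteq> lookup (var_exp j) (max i j)"
      by (auto simp: var_exp_def lookup_single when_def max_def)
    with * show False by simp
  qed
qed auto

lemma var_exp_vecs: "i \<le> m \<Longrightarrow> var_exp i \<in> vecs {1..m}"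
  by (auto simp: var_exp_def intro: vecs_single)

lemma dehom_linear_form_eq: "dehom_linear_form m c = (\<Sum>i\<le>m. single (var_exp i) (c i))"
proof -
  have "{..m} = insert 0 {1..m}" by auto
  then show ?thesis by (auto simp: dehom_linear_form_def var_exp_def intro!: sum.cong)
qed

lemma lookup_dehom_linear_form: "i \<le> m \<Longrightarrow> lookup (dehom_linear_form m c) (var_exp i) = c i"
  by (simp add: dehom_linear_form_eq lookup_sum lookup_single when_def var_exp_inj)

lemma keys_dehom_linear_form: "keys (dehom_linear_form m c) = var_exp ` {i. i \<le> m \<and> c i \<noteq> 0}"
proof
  have "keys (dehom_linear_form m c) \<subseteq> var_exp ` {..m}"
    unfolding dehom_linear_form_eq by (rule order.trans[OF keys_sum]) auto
  then show "keys (dehom_linear_form m c) \<subseteq> var_exp ` {i. i \<le> m \<and> c i \<noteq> 0}"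
    by (auto simp: in_keys_iff lookup_dehom_linear_form)
qed (auto simp: in_keys_iff lookup_dehom_linear_form)

text \<open>
  The exponent of \<open>y\<^sub>i\<close> in \<open>z\<^sup>v\<close>, regarded as a homogeneous Laurent monomial of degree \<open>0\<close>.
\<close>

definition homog_exp :: "nat \<Rightarrow> zvec \<Rightarrow> nat \<Rightarrow> int" where
  "homog_exp m v i = (if i = 0 then - (\<Sum>j\<in>{1..m}. lookup v j) else lookup v i)"

lemma homog_exp_add: "homog_exp m (u + v) j = homog_exp m u j + homog_exp m v j"
  by (simp add: homog_exp_def lookup_add sum.distrib)

lemma homog_exp_var_exp:
  assumes "i \<le> m"
  shows "homog_exp m (var_exp i) j = of_bool (i = j) - of_bool (j = 0)"
  using assms by (auto simp: homog_exp_def var_exp_def lookup_single when_def sum.delta)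

text \<open>
  The line is spanned by a torus point \<open>t\<close> and by its point \<open>r\<close> on the hyperplane \<open>y\<^sub>0 = 0\<close>.  After
  scaling \<open>t\<close> to \<open>y\<^sub>0 = 1\<close>, the affine points of the line are the \<open>t + s r\<close>, and \<open>z\<^sub>b\<close> is an affine
  coordinate on the line when \<open>r\<close> has coordinate \<open>1\<close> at \<open>b\<close>.
\<close>

locale torus_line =
  fixes m b :: nat and t r :: "nat \<Rightarrow> 'k::field" and L :: "(nat \<Rightarrow> 'k) set"
  assumes inf: "infinite (UNIV :: 'k set)"
    and t0: "t 0 = 1" and r0: "r 0 = 0" and b: "b \<in> {1..m}" and rb: "r b = 1"
    and t_nz: "i \<le> m \<Longrightarrow> t i \<noteq> 0"
    and torus: "line_torus m L = {\<lambda>i. t i + s * r i | s. \<forall>i\<le>m. t i + s * r i \<noteq> 0}"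
begin

definition pt :: "'k \<Rightarrow> nat \<Rightarrow> 'k" where "pt s i = t i + s * r i"

definition good :: "'k set" where "good = {s. \<forall>i\<le>m. pt s i \<noteq> 0}"

lemma finite_bad: "finite (- good)"
proof -
  have "finite {s. pt s i = 0}" if "i \<le> m" for i
  proof (cases "r i = 0")
    case True
    then show ?thesis using t_nz[OF that] by (simp add: pt_def)
  next
    case False
    then have "{s. pt s i = 0} \<subseteq> {- t i / r i}"
      by (auto simp: pt_def field_simps eq_neg_iff_add_eq_0 add.commute)
    then show ?thesis by (rule finite_subset) simp
  qed
  then have "finite (\<Union>i\<in>{..m}. {s. pt s i = 0})" by blast
  also have "(\<Union>i\<in>{..m}. {s. pt s i = 0}) = - good" by (auto simp: good_def)
  finally show ?thesis .
qed

lemma infinite_good: "infinite good"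
  using finite_bad inf by (metis Compl_partition finite_UnI)

lemma line_ideal_iff:
  "f \<in> line_ideal m L \<longleftrightarrow> f \<in> laurent_ring {1..m} \<and> (\<forall>s\<in>good. lin_ext (mon (pt s)) f = 0)"
  unfolding line_ideal_def torus good_def pt_def[abs_def] laurent_eval_eq by auto

lemma mon_pt_var_exp: "mon (pt s) (var_exp i) = pt s i"
  by (simp add: mon_def var_exp_def pt_def t0 r0)

lemma mon_pt_add:
  "s \<in> good \<Longrightarrow> u \<in> vecs {1..m} \<Longrightarrow> v \<in> vecs {1..m} \<Longrightarrow> mon (pt s) (u + v) = mon (pt s) u * mon (pt s) v"
  by (rule mon_add[of "{1..m}"]) (auto simp: good_def)

lemma line_ideal_is_ideal: "is_ideal (laurent_ring {1..m}) (line_ideal m L)"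
  unfolding laurent_ring_eq
proof (rule is_idealI)
  fix a :: zvec and c and f :: "(nat, 'k) laurent" assume a: "a \<in> vecs {1..m}" and f: "f \<in> line_ideal m L"
  have "lin_ext (mon (pt s)) (single a c * f) = 0" if "s \<in> good" for s
  proof -
    have "lin_ext (\<lambda>v. mon (pt s) (a + v)) f = lin_ext (\<lambda>v. mon (pt s) a * mon (pt s) v) f"
      using f by (intro lin_ext_cong mon_pt_add that a) (auto simp: line_ideal_iff laurent_ring_def)
    then show ?thesis using f that by (simp add: lin_ext_single_mult lin_ext_scale line_ideal_iff)
  qed
  moreover have "single a c * f \<in> laurent_ring {1..m}"
    using f a unfolding laurent_ring_eq line_ideal_iff
    by (intro supported_mult submonoid_vecs) (auto intro: supported_single)
  ultimately show "single a c * f \<in> line_ideal m L" by (simp add: line_ideal_iff)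
qed (auto simp: line_ideal_iff laurent_ring_eq lin_ext_add intro: supported_add)

lemma line_ideal_diff: "f \<in> line_ideal m L \<Longrightarrow> g \<in> line_ideal m L \<Longrightarrow> f - g \<in> line_ideal m L"
  by (auto simp: line_ideal_iff laurent_ring_eq lin_ext_diff intro: supported_diff)

text \<open>
  On the line, \<open>z\<^sub>i\<close> is an affine function of \<open>z\<^sub>b\<close>; this is the relation expressing it.
\<close>

definition rel_form :: "nat \<Rightarrow> (nat, 'k) laurent" where
  "rel_form i = single (var_exp i) 1 - single 0 (t i - r i * t b) - single (var_exp b) (r i)"

lemma rel_form_line_ideal:
  assumes "i \<le> m"
  shows "rel_form i \<in> line_ideal m L"
proof -
  have "rel_form i \<in> laurent_ring {1..m}"
    using assms b unfolding rel_form_def laurent_ring_eq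
    by (intro supported_diff supported_single var_exp_vecs) auto
  moreover have "lin_ext (mon (pt s)) (rel_form i) = 0" for s
  proof -
    have "mon (pt s) 0 = 1" by (simp add: mon_def)
    then show ?thesis
      by (simp add: rel_form_def lin_ext_diff mon_pt_var_exp) (simp add: pt_def rb algebra_simps)
  qed
  ultimately show ?thesis by (simp add: line_ideal_iff)
qed

text \<open>
  If \<open>y\<^sub>i\<close> occurs with exponent above its lower bound and \<open>i \<noteq> 0, b\<close>, one factor \<open>y\<^sub>i\<close> is traded for a
  combination of \<open>y\<^sub>0\<close> and \<open>y\<^sub>b\<close>.  The difference is a multiple of the relation for \<open>y\<^sub>i\<close> whose
  monomial factor, of degree \<open>-1\<close>, still satisfies all lower bounds; being written in degree \<open>0\<close>, it
  satisfies them with the exponent of \<open>y\<^sub>0\<close> diminished by one.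
\<close>

lemma reduce_monomial:
  assumes S: "0 \<in> S" "\<And>x y. x \<in> S \<Longrightarrow> y \<in> S \<Longrightarrow> x + y \<in> S"
    and gen: "\<And>i v k. i \<in> {1..m} \<Longrightarrow> v \<in> vecs {1..m} \<Longrightarrow>
        (\<forall>j\<le>m. a j \<le> homog_exp m v j - of_bool (j = 0)) \<Longrightarrow> single v k * rel_form i \<in> S"
    and v: "v \<in> vecs {1..m}" "\<forall>j\<le>m. a j \<le> homog_exp m v j"
  shows "\<exists>N. single v k - N \<in> S \<and>
    keys N \<subseteq> {v \<in> vecs {1..m}. (\<forall>j\<le>m. a j \<le> homog_exp m v j) \<and> (\<forall>j\<in>{1..m} - {b}. lookup v j = a j)}"
  using v
proof (induction "nat (\<Sum>j\<in>{1..m} - {b}. lookup v j - a j)" arbitrary: v k rule: less_induct)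
  case less
  have nonneg: "0 \<le> lookup v j - a j" if "j \<in> {1..m}" for j
    using less.prems(2) that by (auto simp: homog_exp_def split: if_splits dest!: spec[of _ j])
  show ?case
  proof (cases "\<forall>j\<in>{1..m} - {b}. lookup v j = a j")
    case True
    then show ?thesis using less.prems S(1) by (intro exI[of _ "single v k"]) auto
  next
    case False
    then obtain i where i: "i \<in> {1..m}" "i \<noteq> b" "lookup v i \<noteq> a i" by blast
    then have gt: "a i < homog_exp m v i" using nonneg[of i] by (auto simp: homog_exp_def)
    define v1 where "v1 = v - var_exp i"
    define v2 where "v2 = v1 + var_exp b"
    have vecs1: "v1 \<in> vecs {1..m}"
      unfolding v1_def using i by (intro vecs_diff less.prems var_exp_vecs) auto
    then have vecs2: "v2 \<in> vecs {1..m}"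
      unfolding v2_def using b by (intro vecs_add var_exp_vecs) auto
    have v_eq: "v = v1 + var_exp i" by (simp add: v1_def)
    have h1: "homog_exp m v1 j = homog_exp m v j - of_bool (i = j) + of_bool (j = 0)" for j
      using i by (simp add: v_eq homog_exp_add homog_exp_var_exp)
    have h2: "homog_exp m v2 j = homog_exp m v j - of_bool (i = j) + of_bool (b = j)" for j
      using b by (simp add: v2_def homog_exp_add homog_exp_var_exp h1)
    have ge: "a j \<le> homog_exp m v j - of_bool (i = j)" if "j \<le> m" for j
      using gt less.prems(2) that by (cases "i = j") auto
    have ge1: "\<forall>j\<le>m. a j \<le> homog_exp m v1 j"
      and ge1': "\<forall>j\<le>m. a j \<le> homog_exp m v1 j - of_bool (j = 0)"
      and ge2: "\<forall>j\<le>m. a j \<le> homog_exp m v2 j"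
      using ge by (force simp: h1 h2)+
    have l1: "lookup v1 j = lookup v j - of_bool (j = i)" for j
      using i by (auto simp: v1_def var_exp_def lookup_minus lookup_single when_def)
    have l2: "lookup v2 j = lookup v1 j" if "j \<noteq> b" for j
      using b that by (auto simp: v2_def var_exp_def lookup_add lookup_single when_def)
    have "(\<Sum>j\<in>{1..m} - {b}. lookup v1 j - a j) < (\<Sum>j\<in>{1..m} - {b}. lookup v j - a j)"
      using i by (intro sum_strict_mono_ex1) (auto simp: l1)
    moreover have "0 \<le> (\<Sum>j\<in>{1..m} - {b}. lookup v1 j - a j)"
      using ge1 by (intro sum_nonneg) (auto simp: homog_exp_def split: if_splits)
    ultimately have less1: "nat (\<Sum>j\<in>{1..m} - {b}. lookup v1 j - a j) < nat (\<Sum>j\<in>{1..m} - {b}. lookup v j - a j)"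
      by linarith
    moreover have "(\<Sum>j\<in>{1..m} - {b}. lookup v2 j - a j) = (\<Sum>j\<in>{1..m} - {b}. lookup v1 j - a j)"
      by (intro sum.cong) (auto simp: l2)
    ultimately have less2: "nat (\<Sum>j\<in>{1..m} - {b}. lookup v2 j - a j) < nat (\<Sum>j\<in>{1..m} - {b}. lookup v j - a j)"
      by simp
    obtain N1 where N1: "single v1 (k * (t i - r i * t b)) - N1 \<in> S"
      "keys N1 \<subseteq> {v \<in> vecs {1..m}. (\<forall>j\<le>m. a j \<le> homog_exp m v j) \<and> (\<forall>j\<in>{1..m} - {b}. lookup v j = a j)}"
      using less.hyps[OF less1 vecs1 ge1] by blast
    obtain N2 where N2: "single v2 (k * r i) - N2 \<in> S"
      "keys N2 \<subseteq> {v \<in> vecs {1..m}. (\<forall>j\<le>m. a j \<le> homog_exp m v j) \<and> (\<forall>j\<in>{1..m} - {b}. lookup v j = a j)}"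
      using less.hyps[OF less2 vecs2 ge2] by blast
    have "single v k = single v1 k * rel_form i + single v1 (k * (t i - r i * t b)) + single v2 (k * r i)"
      by (simp add: rel_form_def right_diff_distrib Poly_Mapping.mult_single v_eq v2_def)
    then have "single v k - (N1 + N2) = single v1 k * rel_form i +
        ((single v1 (k * (t i - r i * t b)) - N1) + (single v2 (k * r i) - N2))"
      by (simp add: algebra_simps)
    also have "\<dots> \<in> S" by (intro S(2) gen N1 N2 i vecs1 ge1')
    finally show ?thesis
      using N1(2) N2(2) Poly_Mapping.keys_add[of N1 N2] by (intro exI[of _ "N1 + N2"]) blast
  qed
qed

text \<open>
  The remaining terms differ only in their exponents of \<open>y\<^sub>0\<close> and \<open>y\<^sub>b\<close>.  Up to a common monomial, they
  form a polynomial in \<open>z\<^sub>b\<close>, which vanishes at infinitely many points.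
\<close>

lemma reduced_eq_zero:
  assumes N: "N \<in> line_ideal m L"
    and keys: "keys N \<subseteq> {v \<in> vecs {1..m}. (\<forall>j\<le>m. a j \<le> homog_exp m v j) \<and> (\<forall>j\<in>{1..m} - {b}. lookup v j = a j)}"
  shows "N = 0"
proof -
  \<comment> \<open>The lower bound on the exponent of \<open>z\<^sub>b\<close> makes \<open>n\<close> injective on the support.\<close>
  define n where "n v = nat (lookup v b - a b)" for v :: zvec
  have ge: "a b \<le> lookup v b" if "v \<in> keys N" for v
    using keys that b by (auto simp: homog_exp_def dest!: subsetD split: if_splits)
  define p where "p = (\<Sum>v\<in>keys N. monom (lookup N v) (n v))"
  have root: "poly p (t b + s) = 0" if s: "s \<in> good" for s
  proof -
    define C where "C = (\<Prod>j\<in>{1..m} - {b}. pt s j powi a j)"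
    have x: "pt s b = t b + s" "pt s b \<noteq> 0" using s b by (auto simp: pt_def rb good_def)
    have "C \<noteq> 0" using s by (auto simp: C_def good_def)
    have "mon (pt s) v = C * pt s b powi a b * (t b + s) ^ n v" if v: "v \<in> keys N" for v
    proof -
      have "mon (pt s) v = (\<Prod>j\<in>{1..m}. pt s j powi lookup v j)"
        using keys v by (intro mon_superset) (auto simp: vecs_def dest!: subsetD)
      also have "\<dots> = pt s b powi lookup v b * (\<Prod>j\<in>{1..m} - {b}. pt s j powi lookup v j)"
        using b by (intro prod.remove) auto
      also have "(\<Prod>j\<in>{1..m} - {b}. pt s j powi lookup v j) = C"
        unfolding C_def using keys v by (intro prod.cong) auto
      also have "pt s b powi lookup v b = pt s b powi (a b + int (n v))"
        using ge[OF v] by (simp add: n_def)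
      also have "\<dots> = pt s b powi a b * (t b + s) ^ n v"
        using x by (simp add: power_int_add)
      finally show ?thesis by (simp add: mult_ac)
    qed
    then have "lin_ext (mon (pt s)) N = C * pt s b powi a b * (\<Sum>v\<in>keys N. lookup N v * (t b + s) ^ n v)"
      by (simp add: lin_ext_def sum_distrib_left mult_ac)
    then have "(\<Sum>v\<in>keys N. lookup N v * (t b + s) ^ n v) = 0"
      using N s \<open>C \<noteq> 0\<close> x by (auto simp: line_ideal_iff)
    then show ?thesis by (simp add: p_def poly_sum poly_monom)
  qed
  have "p = 0"
  proof (rule ccontr)
    assume "p \<noteq> 0"
    then have "finite {x. poly p x = 0}" by (rule poly_roots_finite)
    then have "finite ((\<lambda>s. t b + s) ` good)" by (rule finite_subset[rotated]) (auto simp: root)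
    then show False using infinite_good by (simp add: finite_image_iff)
  qed
  have inj: "u = v" if "u \<in> keys N" "v \<in> keys N" "n u = n v" for u v
  proof (rule poly_mapping_eqI)
    fix j
    have "lookup u b = lookup v b" using that ge[of u] ge[of v] by (simp add: n_def)
    moreover have "lookup u j = a j \<and> lookup v j = a j" if "j \<in> {1..m} - {b}"
      using keys \<open>u \<in> keys N\<close> \<open>v \<in> keys N\<close> that by blast
    moreover have "lookup u j = 0 \<and> lookup v j = 0" if "j \<notin> {1..m}"
      using keys \<open>u \<in> keys N\<close> \<open>v \<in> keys N\<close> that unfolding vecs_def in_keys_iff[symmetric] not_in_keys_iff_lookup_eq_zero[symmetric] by blast
    ultimately show "lookup u j = lookup v j"
      by (metis DiffI singletonD)
  qed
  have "lookup N v = 0" if v: "v \<in> keys N" for v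
  proof -
    have "coeff p (n v) = (\<Sum>u\<in>keys N. if u = v then lookup N v else 0)"
      unfolding p_def coeff_sum coeff_monom using inj v by (intro sum.cong) auto
    also have "\<dots> = lookup N v" using v by simp
    finally show ?thesis using \<open>p = 0\<close> by simp
  qed
  then show ?thesis by (intro poly_mapping_eqI) (metis in_keys_iff lookup_zero)
qed

text \<open>
  The ideal of \<open>L\<degree>\<close> is spanned by monomial multiples of the relations, with control of the exponents.
  The reduction stays inside the ideal, so that the reduced remainder lies in it and is zero.
\<close>

lemma line_ideal_induct:
  assumes f: "f \<in> line_ideal m L" "\<forall>v\<in>keys f. \<forall>j\<le>m. a j \<le> homog_exp m v j"
    and S: "0 \<in> S" "\<And>x y. x \<in> S \<Longrightarrow> y \<in> S \<Longrightarrow> x + y \<in> S"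
    and gen: "\<And>i v k. i \<in> {1..m} \<Longrightarrow> v \<in> vecs {1..m} \<Longrightarrow>
        (\<forall>j\<le>m. a j \<le> homog_exp m v j - of_bool (j = 0)) \<Longrightarrow> single v k * rel_form i \<in> S"
  shows "f \<in> S"
proof -
  let ?S = "S \<inter> line_ideal m L"
  let ?A = "{v \<in> vecs {1..m}. \<forall>j\<le>m. a j \<le> homog_exp m v j}"
  let ?B = "{v \<in> vecs {1..m}. (\<forall>j\<le>m. a j \<le> homog_exp m v j) \<and> (\<forall>j\<in>{1..m} - {b}. lookup v j = a j)}"
  have S': "0 \<in> ?S" "x \<in> ?S \<Longrightarrow> y \<in> ?S \<Longrightarrow> x + y \<in> ?S" for x y
    using S is_idealD(1,2)[OF line_ideal_is_ideal] by auto
  have gen': "single v k * rel_form i \<in> ?S"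
    if "i \<in> {1..m}" "v \<in> vecs {1..m}" "\<forall>j\<le>m. a j \<le> homog_exp m v j - of_bool (j = 0)" for i v k
    using gen[OF that] that(1,2)
    by (auto intro!: is_idealD(3)[OF line_ideal_is_ideal] rel_form_line_ideal simp: laurent_ring_eq supported_single)
  have "keys f \<subseteq> ?A" using f by (auto simp: line_ideal_iff laurent_ring_def)
  then have "\<exists>N. f - N \<in> ?S \<and> keys N \<subseteq> ?B"
  proof (induction f rule: monomial_induct)
    case zero
    show ?case using S'(1) by (intro exI[of _ 0]) auto
  next
    case (single v c)
    then show ?case by (intro reduce_monomial S' gen') auto
  next
    case (add f g)
    then obtain N1 N2 where "f - N1 \<in> ?S" "g - N2 \<in> ?S" and keys: "keys N1 \<subseteq> ?B" "keys N2 \<subseteq> ?B" by blast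
    then have "(f - N1) + (g - N2) \<in> ?S" by (intro S')
    also have "(f - N1) + (g - N2) = (f + g) - (N1 + N2)" by simp
    finally show ?case
      using keys Poly_Mapping.keys_add[of N1 N2] by (intro exI[of _ "N1 + N2"]) blast
  qed
  then obtain N where N: "f - N \<in> ?S" "keys N \<subseteq> ?B" by blast
  have "f - (f - N) \<in> line_ideal m L"
    by (rule line_ideal_diff) (use f(1) N(1) in auto)
  then have "N = 0" using N(2) by (intro reduced_eq_zero) auto
  then show ?thesis using N(1) by simp
qed

end

text \<open>
  An element outside the span of \<open>G\<close> is separated from \<open>G\<close> by a linear functional.
\<close>

lemma separating_functional:
  fixes G :: "('a::comm_monoid_add \<Rightarrow>\<^sub>0 'k::field) set"
  assumes "\<nexists>F k. finite F \<and> F \<subseteq> G \<and> x = (\<Sum>g\<in>F. single 0 (k g) * g)"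
  shows "\<exists>h :: ('a \<Rightarrow>\<^sub>0 'k) \<Rightarrow> 'k. (\<forall>f g. h (f + g) = h f + h g) \<and>
    (\<forall>c f. h (single 0 c * f) = c * h f) \<and> (\<forall>g\<in>G. h g = 0) \<and> h x \<noteq> 0"
proof -
  define sc :: "'k \<Rightarrow> ('a \<Rightarrow>\<^sub>0 'k) \<Rightarrow> 'a \<Rightarrow>\<^sub>0 'k" where "sc = (\<lambda>c f. single 0 c * f)"
  interpret V: vector_space sc
    by standard (auto simp: sc_def single_add distrib_left distrib_right mult.assoc[symmetric] Poly_Mapping.mult_single)
  interpret P: vector_space_pair sc "(*)"
    by standard (auto simp: algebra_simps)
  obtain B where B: "B \<subseteq> G" "V.independent B" "G \<subseteq> V.span B"
    using V.maximal_independent_subset[of G] by blast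
  have "x \<notin> V.span B"
  proof
    assume "x \<in> V.span B"
    then obtain F k where "finite F" "F \<subseteq> B" "x = (\<Sum>g\<in>F. single 0 (k g) * g)"
      unfolding V.span_explicit unfolding sc_def by auto
    moreover from this have "F \<subseteq> G" using B(1) by simp
    ultimately show False using assms by blast
  qed
  then have x: "x \<notin> B" "V.independent (insert x B)"
    using V.span_base V.independent_insertI[OF _ B(2)] by blast+
  obtain h where h: "Vector_Spaces.linear sc (*) h" "\<forall>y\<in>insert x B. h y = (if y = x then 1 else 0)"
    using P.linear_independent_extend[OF x(2), of "\<lambda>y. if y = x then 1 else 0"]
    by (elim exE conjE) (rule that)
  interpret h: Vector_Spaces.linear sc "(*)" h by (rule h(1))
  have "h g = 0" if "g \<in> G" for g
  proof (rule P.linear_eq_0_on_span[OF h(1)])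
    show "g \<in> V.span B" using B(3) that by blast
    fix y assume "y \<in> B"
    then have "y \<noteq> x" "y \<in> insert x B" using x(1) by blast+
    then show "h y = 0" using h(2) by simp
  qed
  moreover have "h (single 0 c * f) = c * h f" for c f
    using h.scale[of c f] by (simp add: sc_def)
  moreover have "h (f + g) = h f + h g" for f g by (rule h.add)
  moreover have "h x \<noteq> 0" using h(2) by simp
  ultimately show ?thesis by blast
qed

context torus_line
begin

text \<open>
  A linear form vanishing on the torus points of the line vanishes on the whole line.
\<close>

lemma linear_form_vanishes:
  assumes "dehom_linear_form m c \<in> line_ideal m L"
  shows "(\<Sum>i\<le>m. c i * t i) = 0" "(\<Sum>i\<le>m. c i * r i) = 0"
proof -
  have eq: "(\<Sum>i\<le>m. c i * t i) + s * (\<Sum>i\<le>m. c i * r i) = 0" if "s \<in> good" for s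
  proof -
    have "(\<Sum>i\<le>m. c i * pt s i) = 0"
      using assms that by (simp add: line_ideal_iff dehom_linear_form_eq lin_ext_sum mon_pt_var_exp)
    then show ?thesis by (simp add: pt_def sum.distrib sum_distrib_left algebra_simps)
  qed
  have "0 \<in> good" using t_nz by (simp add: good_def pt_def)
  from eq[OF this] show *: "(\<Sum>i\<le>m. c i * t i) = 0" by simp
  obtain s where "s \<in> good" "s \<noteq> 0"
    using infinite_good by (metis finite.emptyI finite_insert finite_subset insertCI subsetI)
  with eq[of s] * show "(\<Sum>i\<le>m. c i * r i) = 0" by simp
qed

text \<open>
  If \<open>G\<close> did not span the relation for \<open>z\<^sub>i\<close>, duality would give a point \<open>y\<close> annihilated by \<open>G\<close> but
  not by that relation.  Correcting \<open>y\<close> by points of the line yields \<open>y0\<close> with coordinates \<open>0\<close> at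
  \<open>0\<close> and \<open>b\<close> but not at \<open>i\<close>.  The curve \<open>y0 + \<tau> r + \<tau>\<^sup>2 t\<close> lies in the linear space cut out by \<open>G\<close>, so
  the vector of its orders of vanishing at \<open>\<tau> = 0\<close> lies in all tropical hypersurfaces of \<open>G\<close>.  But
  these orders are \<open>0\<close>, \<open>1\<close>, \<open>2\<close> at \<open>i\<close>, \<open>b\<close>, \<open>0\<close>, so that the relation between \<open>z\<^sub>i\<close>, \<open>z\<^sub>b\<close> and \<open>1\<close> has a
  strictly minimal term, contradicting that \<open>G\<close> is a tropical basis.
\<close>

lemma rel_form_in_span:
  assumes basis: "tropical_basis {1..m} (line_ideal m L) G"
    and lin: "\<forall>g\<in>G. \<exists>c. g = dehom_linear_form m c" and i: "i \<in> {1..m}"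
  shows "\<exists>F k. finite F \<and> F \<subseteq> G \<and> rel_form i = (\<Sum>g\<in>F. single 0 (k g) * g)"
proof (rule ccontr)
  assume "\<not> ?thesis"
  then obtain h :: "(nat, 'k) laurent \<Rightarrow> 'k" where h_add: "\<And>f g. h (f + g) = h f + h g"
    and h_scale: "\<And>c f. h (single 0 c * f) = c * h f" and h_G: "\<And>g. g \<in> G \<Longrightarrow> h g = 0"
    and h_i: "h (rel_form i) \<noteq> 0"
    using separating_functional[of G "rel_form i"] by blast
  define y where "y k = h (single (var_exp k) 1)" for k
  have h_single: "h (single (var_exp k) c) = c * y k" for k c
    using h_scale[of c "single (var_exp k) 1"] by (simp add: Poly_Mapping.mult_single y_def)
  have h_0: "h 0 = 0" using h_scale[of 0 0] by simp
  have h_sum: "h (\<Sum>x\<in>A. f x) = (\<Sum>x\<in>A. h (f x))" for f :: "nat \<Rightarrow> (nat, 'k) laurent" and A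
    by (induction A rule: infinite_finite_induct) (auto simp: h_0 h_add)
  have h_diff: "h (f - g) = h f - h g" for f g
    using h_add[of "f - g" g] by simp
  define y0 where "y0 k = y k - y 0 * t k - (y b - y 0 * t b) * r k" for k
  have "h (single 0 c) = c * y 0" for c using h_single[of 0 c] by (simp add: var_exp_def)
  then have "h (rel_form i) = y i - (t i - r i * t b) * y 0 - r i * y b"
    by (simp only: rel_form_def h_diff h_single mult_1_left)
  then have "h (rel_form i) = y0 i" by (simp add: y0_def algebra_simps)
  with h_i have "y0 i \<noteq> 0" by simp
  have "y0 0 = 0" "y0 b = 0" by (auto simp: y0_def t0 r0 rb)
  then have "i \<noteq> b" using \<open>y0 i \<noteq> 0\<close> by auto
  define W :: "nat \<Rightarrow> real" where "W k = (if y0 k \<noteq> 0 then 0 else if r k \<noteq> 0 then 1 else 2)" for k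
  \<comment> \<open>The orders relative to that of coordinate \<open>0\<close>, which is \<open>2\<close>.\<close>
  define w :: "nat \<Rightarrow> real" where "w k = (if k \<in> {1..m} then W k - 2 else 0)" for k
  have weight_w: "weight w (var_exp k) = W k - 2" if "k \<le> m" for k
    using that \<open>y0 0 = 0\<close> by (auto simp: var_exp_def w_def W_def r0)
  have "unique_min w (rel_form i) (var_exp i)"
  proof -
    have "keys (rel_form i) \<subseteq> {var_exp i, var_exp 0, var_exp b}"
      using keys_diff[of "single (var_exp i) 1 - single 0 (t i - r i * t b)" "single (var_exp b) (r i)"]
        keys_diff[of "single (var_exp i) 1" "single 0 (t i - r i * t b)"]
      by (auto simp: rel_form_def var_exp_def split: if_splits)
    moreover have "lookup (rel_form i) (var_exp i) = 1"
      using i \<open>i \<noteq> b\<close> b by (auto simp: rel_form_def lookup_minus lookup_single when_def var_exp_inj)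
        (auto simp: var_exp_def)
    moreover have "weight w (var_exp i) < weight w (var_exp 0)" "weight w (var_exp i) < weight w (var_exp b)"
      using i b \<open>y0 i \<noteq> 0\<close> \<open>y0 0 = 0\<close> \<open>y0 b = 0\<close> by (auto simp: weight_w) (auto simp: W_def r0 rb)
    ultimately show ?thesis by (auto simp: unique_min_def in_keys_iff)
  qed
  moreover have "\<not> unique_min w g e" if g: "g \<in> G" for g e
  proof
    assume min: "unique_min w g e"
    obtain c where c: "g = dehom_linear_form m c" using lin g by blast
    obtain k where k: "e = var_exp k" "k \<le> m" "c k \<noteq> 0"
      using min by (auto simp: unique_min_def c keys_dehom_linear_form)
    have less: "W k < W l" if "l \<le> m" "l \<noteq> k" "c l \<noteq> 0" for l
      using min that k by (auto simp: unique_min_def c keys_dehom_linear_form var_exp_inj weight_w)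
    \<comment> \<open>The coefficient of the curve at the order of coordinate \<open>k\<close>; all coordinates of larger order vanish there.\<close>
    define Y where "Y = (if W k = 0 then y0 else if W k = 1 then r else t)"
    have "Y l = 0" if "l \<le> m" "l \<noteq> k" "c l \<noteq> 0" for l
      using less[OF that] by (auto simp: Y_def W_def split: if_splits)
    then have "(\<Sum>l\<le>m. c l * Y l) = (\<Sum>l\<le>m. if l = k then c k * Y k else 0)"
      by (intro sum.cong) auto
    then have "(\<Sum>l\<le>m. c l * Y l) = c k * Y k" using k by simp
    moreover have "Y k \<noteq> 0" using t_nz[OF k(2)] by (auto simp: Y_def W_def split: if_splits)
    moreover have "(\<Sum>l\<le>m. c l * Y l) = 0"
    proof -
      have gI: "dehom_linear_form m c \<in> line_ideal m L"
        using basis g c by (auto simp: tropical_basis_def)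
      have "(\<Sum>l\<le>m. c l * y l) = h g"
        by (simp add: c dehom_linear_form_eq h_sum h_single)
      also have "\<dots> = 0" by (rule h_G[OF g])
      finally have "(\<Sum>l\<le>m. c l * y l) = 0" .
      moreover have "(\<Sum>l\<le>m. c l * y0 l) = (\<Sum>l\<le>m. c l * y l) - y 0 * (\<Sum>l\<le>m. c l * t l)
          - (y b - y 0 * t b) * (\<Sum>l\<le>m. c l * r l)"
        by (simp add: y0_def sum_distrib_left sum_subtractf[symmetric] algebra_simps)
      ultimately show ?thesis
        using linear_form_vanishes[OF gI] by (simp add: Y_def)
    qed
    ultimately show False using k(3) by simp
  qed
  moreover have "w \<in> real_vecs {1..m}" by (auto simp: real_vecs_def w_def)
  moreover have "G \<subseteq> line_ideal m L" using basis by (simp add: tropical_basis_def)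
  moreover have "line_ideal m L \<subseteq> laurent_ring {1..m}" by (auto simp: line_ideal_iff)
  moreover have "rel_form i \<in> line_ideal m L" using i by (intro rel_form_line_ideal) auto
  ultimately show False
    using basis tropical_basis_iff[OF line_ideal_is_ideal, of G] trop_hypersurface_iff[of _ "{1..m}" w]
    by (meson subsetD)
qed

end

lemma torus_line_exists:
  fixes L :: "(nat \<Rightarrow> 'k::field) set"
  assumes inf: "infinite (UNIV :: 'k set)" and L: "projective_line m L" "line_torus m L \<noteq> {}"
  shows "\<exists>b t r. torus_line m b t r L"
proof -
  obtain p q where pq': "(\<forall>i>m. p i = 0 \<and> q i = 0) \<and>
      (\<forall>s t. (\<forall>i. s * p i + t * q i = 0) \<longrightarrow> s = 0 \<and> t = 0) \<and>
      L = {\<lambda>i. s * p i + t * q i | s t. True}"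
    using L(1) unfolding projective_line_def by (elim exE) (rule that)
  then have pq: "\<forall>i>m. p i = 0 \<and> q i = 0"
      "\<And>s t. (\<And>i. s * p i + t * q i = 0) \<Longrightarrow> s = 0 \<and> t = 0"
      "L = {\<lambda>i. s * p i + t * q i | s t. True}"
    by blast+
  obtain u0 where u0: "u0 \<in> L" "\<forall>i\<le>m. u0 i \<noteq> 0"
    using L(2) unfolding line_torus_def by blast
  obtain \<sigma>0 \<tau>0 where "u0 = (\<lambda>i. \<sigma>0 * p i + \<tau>0 * q i)"
    using u0(1) unfolding pq(3) by blast
  with u0(2) have st: "\<forall>i\<le>m. \<sigma>0 * p i + \<tau>0 * q i \<noteq> 0" by simp
  define y where "y i = \<sigma>0 * p i + \<tau>0 * q i" for i
  have y_nz: "y i \<noteq> 0" if "i \<le> m" for i using st that by (simp add: y_def)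
  have "p 0 \<noteq> 0 \<or> q 0 \<noteq> 0" using y_nz[of 0] by (auto simp: y_def)
  \<comment> \<open>The point of the line on \<open>y\<^sub>0 = 0\<close>; it is nonzero since \<open>p, q\<close> are independent.\<close>
  define r' where "r' i = q 0 * p i - p 0 * q i" for i
  have "\<exists>b. r' b \<noteq> 0"
  proof (rule ccontr)
    assume "\<not> ?thesis"
    then have "\<And>i. q 0 * p i + (- p 0) * q i = 0" by (simp add: r'_def)
    from pq(2)[OF this] \<open>p 0 \<noteq> 0 \<or> q 0 \<noteq> 0\<close> show False by simp
  qed
  then obtain b where b: "r' b \<noteq> 0" by blast
  have "r' 0 = 0" by (simp add: r'_def)
  then have "b \<noteq> 0" using b by metis
  moreover have "b \<le> m" using b pq(1) by (auto simp: r'_def not_le[symmetric])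
  ultimately have b_mem: "b \<in> {1..m}" by simp
  define t where "t i = y i / y 0" for i
  define r where "r i = r' i / r' b" for i
  have span: "\<exists>x z. \<forall>i. s * p i + s' * q i = x * t i + z * r i" for s s'
  proof -
    define D where "D = y 0"
    have D: "D \<noteq> 0" using y_nz[of 0] by (simp add: D_def)
    have "s * p i + s' * q i = (s * p 0 + s' * q 0) * t i + ((s * \<tau>0 - s' * \<sigma>0) * r' b / D) * r i" for i
    proof -
      have "D * (s * p i + s' * q i) = (s * p 0 + s' * q 0) * y i + (s * \<tau>0 - s' * \<sigma>0) * r' i"
        by (simp add: D_def y_def r'_def algebra_simps)
      then have "s * p i + s' * q i = ((s * p 0 + s' * q 0) * y i + (s * \<tau>0 - s' * \<sigma>0) * r' i) / D"
        using D by (simp add: eq_divide_eq mult.commute)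
      then show ?thesis using D b by (simp add: t_def r_def D_def[symmetric] add_divide_distrib)
    qed
    then show ?thesis by blast
  qed
  have mem: "(\<lambda>i. x * t i + z * r i) \<in> L" for x z
  proof -
    have "x * t i + z * r i = (x * \<sigma>0 / y 0 + z * q 0 / r' b) * p i + (x * \<tau>0 / y 0 - z * p 0 / r' b) * q i" for i
      by (simp add: t_def r_def y_def[of i] r'_def[of i] ring_distribs add_divide_distrib diff_divide_distrib)
        (simp add: algebra_simps)
    then show ?thesis unfolding pq(3) by blast
  qed
  have t0: "t 0 = 1" and r0: "r 0 = 0" and rb: "r b = 1"
    using y_nz[of 0] b \<open>r' 0 = 0\<close> by (auto simp: t_def r_def)
  have "line_torus m L = {\<lambda>i. t i + s * r i | s. \<forall>i\<le>m. t i + s * r i \<noteq> 0}"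
  proof (intro equalityI subsetI)
    fix z assume "z \<in> line_torus m L"
    then obtain u where u: "u \<in> L" "\<forall>i\<le>m. u i \<noteq> 0" "z = (\<lambda>i. u i / u 0)"
      by (auto simp: line_torus_def)
    obtain x v where xv: "\<And>i. u i = x * t i + v * r i"
      using u(1) span unfolding pq(3) by fastforce
    have "u 0 = x" using xv[of 0] by (simp add: t0 r0)
    then have "x \<noteq> 0" using u(2) by auto
    then have "z = (\<lambda>i. t i + (v / x) * r i)"
      by (simp add: u(3) \<open>u 0 = x\<close> fun_eq_iff) (simp add: xv field_simps)
    moreover have "\<forall>i\<le>m. z i \<noteq> 0" using u \<open>u 0 = x\<close> \<open>x \<noteq> 0\<close> by auto
    ultimately show "z \<in> {\<lambda>i. t i + s * r i | s. \<forall>i\<le>m. t i + s * r i \<noteq> 0}"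
      by (intro CollectI exI[of _ "v / x"]) simp
  next
    fix z assume "z \<in> {\<lambda>i. t i + s * r i | s. \<forall>i\<le>m. t i + s * r i \<noteq> 0}"
    then obtain s where s: "z = (\<lambda>i. t i + s * r i)" "\<forall>i\<le>m. t i + s * r i \<noteq> 0" by blast
    have "z \<in> L" using mem[of 1 s] s(1) by simp
    moreover have "z = (\<lambda>i. z i / z 0)" by (simp add: s(1) t0 r0)
    moreover have "\<forall>i\<le>m. z i \<noteq> 0" using s by simp
    ultimately show "z \<in> line_torus m L"
      unfolding line_torus_def mem_Collect_eq by (intro exI[of _ z] conjI)
  qed
  then have "torus_line m b t r L"
    using inf t0 r0 b_mem rb y_nz by unfold_locales (auto simp: t_def)
  then show ?thesis by blast
qed


section \<open>Lattice points of the dual cone and of the polyhedron\<close>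

lemma pairing_superset:
  assumes "finite A" "keys v \<subseteq> A"
  shows "pairing v u = (\<Sum>i\<in>A. lookup v i * lookup u i)"
  unfolding pairing_def using assms by (intro sum.mono_neutral_left) (auto simp: in_keys_iff)

lemma pairing_zero [simp]: "pairing 0 u = 0"
  by (simp add: pairing_def)

lemma pairing_single [simp]: "pairing (single i c) u = c * lookup u i"
  by (simp add: pairing_def)

lemma pairing_add: "pairing (x + y) u = pairing x u + pairing y u"
proof -
  have "pairing z u = (\<Sum>i\<in>keys x \<union> keys y. lookup z i * lookup u i)"
    if "z = x \<or> z = y \<or> z = x + y" for z
    using that Poly_Mapping.keys_add[of x y] by (intro pairing_superset) auto
  then show ?thesis by (simp add: lookup_add algebra_simps sum.distrib)
qed

lemma pairing_add_right: "pairing x (u + v) = pairing x u + pairing x v"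
  by (simp add: pairing_def lookup_add sum.distrib distrib_left)

lemma pairing_uminus: "pairing (- x) u = - pairing x u"
  using pairing_add[of "- x" x u] by (simp add: eq_neg_iff_add_eq_0)

lemma pairing_sum: "pairing (\<Sum>x\<in>A. f x) u = (\<Sum>x\<in>A. pairing (f x) u)"
  by (induction A rule: infinite_finite_induct) (auto simp: pairing_add)

lemma lookup_scale: "lookup (Poly_Mapping.map ((*) c) x) i = c * lookup x i" for x :: qvec
  by (simp add: map.rep_eq when_def)

lemma pairing_scale: "pairing (Poly_Mapping.map ((*) c) x) u = c * pairing x u"
proof -
  have "keys (Poly_Mapping.map ((*) c) x) \<subseteq> keys x" by (auto simp: in_keys_iff lookup_scale)
  then show ?thesis
    by (subst pairing_superset[of "keys x"]) (auto simp: lookup_scale pairing_def sum_distrib_left mult_ac)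
qed

abbreviation rat_vec :: "zvec \<Rightarrow> qvec" where
  "rat_vec \<equiv> Poly_Mapping.map rat_of_int"

lemma lookup_rat_vec [simp]: "lookup (rat_vec v) i = of_int (lookup v i)"
  by (simp add: map.rep_eq when_def)

lemma rat_vec_add: "rat_vec (u + v) = rat_vec u + rat_vec v"
  by (rule poly_mapping_eqI) (simp add: lookup_add)

lemma rat_vec_vecs: "v \<in> vecs I \<Longrightarrow> rat_vec v \<in> vecs I"
  by (auto simp: vecs_def in_keys_iff subset_eq)

lemma generated_cone_dual_iff:
  "(\<forall>(x, y)\<in>generated_cone X. 0 \<le> pairing x u + pairing y v) \<longleftrightarrow>
   (\<forall>(x, y)\<in>X. 0 \<le> pairing x u + pairing y v)"
proof -
  define \<Phi> where "\<Phi> z = pairing (fst z) u + pairing (snd z) v" for z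
  have \<Phi>_add: "\<Phi> (z + z') = \<Phi> z + \<Phi> z'" for z z' by (simp add: \<Phi>_def pairing_add)
  have \<Phi>_scale: "\<Phi> (qscale c z) = c * \<Phi> z" for c z
    by (simp add: \<Phi>_def qscale_def pairing_scale distrib_left)
  have \<Phi>_sum: "\<Phi> (\<Sum>z\<in>A. f z) = (\<Sum>z\<in>A. \<Phi> (f z))" for A and f :: "qvec \<times> qvec \<Rightarrow> qvec \<times> qvec"
  proof (induction A rule: infinite_finite_induct)
    case (insert x F)
    then show ?case by (simp add: \<Phi>_add)
  qed (simp_all add: \<Phi>_def)
  have "x \<in> generated_cone X" if "x \<in> X" for x
  proof -
    have "qscale 1 x = x"
      by (auto simp: qscale_def prod_eq_iff intro!: poly_mapping_eqI simp: lookup_scale)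
    then have "x = (\<Sum>z\<in>{x}. qscale ((\<lambda>_. 1) z) z)" by simp
    moreover have "finite {x}" "{x} \<subseteq> X" "\<forall>z\<in>{x}. 0 \<le> (\<lambda>_. 1 :: rat) z" using that by auto
    ultimately show ?thesis
      unfolding generated_cone_def mem_Collect_eq by (intro exI[of _ "{x}"] exI[of _ "\<lambda>_. 1"] conjI)
  qed
  moreover have "0 \<le> \<Phi> z" if X: "\<forall>x\<in>X. 0 \<le> \<Phi> x" and z: "z \<in> generated_cone X" for z
  proof -
    obtain F c where F: "z = (\<Sum>x\<in>F. qscale (c x) x)" "F \<subseteq> X" "\<forall>x\<in>F. 0 \<le> c x"
      using z unfolding generated_cone_def mem_Collect_eq by blast
    have "\<Phi> z = (\<Sum>x\<in>F. c x * \<Phi> x)" by (simp add: F(1) \<Phi>_sum \<Phi>_scale)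
    also have "\<dots> \<ge> 0" using X F by (intro sum_nonneg mult_nonneg_nonneg) auto
    finally show ?thesis .
  qed
  ultimately have "(\<forall>z\<in>generated_cone X. 0 \<le> \<Phi> z) \<longleftrightarrow> (\<forall>z\<in>X. 0 \<le> \<Phi> z)" by blast
  then show ?thesis by (simp add: \<Phi>_def case_prod_unfold)
qed

text \<open>
  The condition \<open>k \<ge> -\<Delta>\<^sub>i(u)\<close> on the exponent \<open>k\<close> of \<open>y\<^sub>i\<close> in degree \<open>u\<close>.  In this form it avoids infinite
  values and the minimum defining \<open>\<Delta>\<^sub>i(u)\<close>.
\<close>

definition pole_bound :: "qvec set \<Rightarrow> zvec \<Rightarrow> int \<Rightarrow> bool" where
  "pole_bound X u k \<longleftrightarrow> (\<forall>x\<in>X. 0 \<le> pairing x (rat_vec u) + of_int k)"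

lemma pole_bound_mono: "pole_bound X u k \<Longrightarrow> k \<le> l \<Longrightarrow> pole_bound X u l"
  unfolding pole_bound_def by (meson add_left_mono of_int_le_iff order.trans)

lemma pole_bound_add:
  assumes "pole_bound X u k" "pole_bound X v l"
  shows "pole_bound X (u + v) (k + l)"
  unfolding pole_bound_def
proof
  fix x assume "x \<in> X"
  then have "0 \<le> pairing x (rat_vec u) + of_int k" "0 \<le> pairing x (rat_vec v) + of_int l"
    using assms by (auto simp: pole_bound_def)
  then show "0 \<le> pairing x (rat_vec (u + v)) + of_int (k + l)"
    by (simp add: rat_vec_add pairing_add_right)
qed

lemma pairing_evec:
  assumes "i \<le> m"
  shows "pairing (evec m i) (rat_vec v) = of_int (homog_exp m v i)"
  using assms by (simp add: evec_def homog_exp_def pairing_uminus pairing_sum)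

abbreviation lattC where "lattC d m \<sigma> \<Delta> \<equiv> lattice_points d m (coneC_dual d m \<sigma> \<Delta>)"
abbreviation lattP where "lattP d m \<sigma> \<Delta> \<equiv> lattice_points d m (polyP d m \<sigma> \<Delta>)"

text \<open>
  In homogeneous exponents, the rays over \<open>e\<^sub>0\<close> and over \<open>e\<^sub>1, \<dots>, e\<^sub>m\<close> impose conditions of the same shape.
\<close>

lemma lattC_iff:
  "(u, v) \<in> lattC d m \<sigma> \<Delta> \<longleftrightarrow> u \<in> vecs {1..d} \<and> v \<in> vecs {1..m} \<and>
     (\<forall>x\<in>\<sigma>. 0 \<le> pairing x (rat_vec u)) \<and> (\<forall>i\<le>m. pole_bound (\<Delta> i) u (homog_exp m v i))"
proof -
  have "(\<forall>(x, y)\<in>coneC m \<sigma> \<Delta>. 0 \<le> pairing x (rat_vec u) + pairing y (rat_vec v)) \<longleftrightarrow>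
      (\<forall>x\<in>\<sigma>. 0 \<le> pairing x (rat_vec u)) \<and> (\<forall>i\<le>m. pole_bound (\<Delta> i) u (homog_exp m v i))"
    unfolding coneC_def generated_cone_dual_iff
    by (simp add: ball_Un split_paired_Ball_Sigma pole_bound_def pairing_evec) auto
  then show ?thesis by (auto simp: lattice_points_def coneC_dual_def rat_vec_vecs)
qed

lemma uminus_poly_eval_le_iff:
  "- poly_eval X u \<le> ereal (of_rat q) \<longleftrightarrow> (\<forall>x\<in>X. 0 \<le> pairing x u + q)"
proof -
  have "- poly_eval X u \<le> ereal (of_rat q) \<longleftrightarrow> ereal (of_rat (- q)) \<le> poly_eval X u"
    by (subst ereal_uminus_le_reorder) (simp add: of_rat_minus)
  also have "\<dots> \<longleftrightarrow> (\<forall>x\<in>X. - q \<le> pairing x u)"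
    by (simp add: poly_eval_def le_INF_iff of_rat_less_eq)
  also have "\<dots> \<longleftrightarrow> (\<forall>x\<in>X. 0 \<le> pairing x u + q)" by (intro ball_cong) auto
  finally show ?thesis .
qed

lemma le_poly_eval_minus_one_iff:
  "ereal (of_rat q) \<le> poly_eval X u - 1 \<longleftrightarrow> (\<forall>x\<in>X. 0 \<le> pairing x u + (- q - 1))"
proof -
  have "ereal (of_rat q) \<le> poly_eval X u - 1 \<longleftrightarrow> ereal (of_rat (q + 1)) \<le> poly_eval X u"
    by (cases "poly_eval X u") (auto simp: of_rat_add one_ereal_def)
  also have "\<dots> \<longleftrightarrow> (\<forall>x\<in>X. q + 1 \<le> pairing x u)"
    by (simp add: poly_eval_def le_INF_iff of_rat_less_eq)
  also have "\<dots> \<longleftrightarrow> (\<forall>x\<in>X. 0 \<le> pairing x u + (- q - 1))" by (intro ball_cong) auto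
  finally show ?thesis .
qed

text \<open>
  The difference to the dual cone is one unit in the exponent of \<open>y\<^sub>0\<close>: points of \<open>P\<close> are monomials of
  degree \<open>-1\<close> in the \<open>y\<^sub>i\<close>, written as \<open>z\<^sup>v / y\<^sub>0\<close>.
\<close>

lemma lattP_iff:
  "(u, v) \<in> lattP d m \<sigma> \<Delta> \<longleftrightarrow> u \<in> vecs {1..d} \<and> v \<in> vecs {1..m} \<and>
     (\<forall>x\<in>\<sigma>. 0 \<le> pairing x (rat_vec u)) \<and>
     (\<forall>i\<le>m. pole_bound (\<Delta> i) u (homog_exp m v i - of_bool (i = 0)))"
proof -
  have all: "(\<forall>i\<le>m. Q i) \<longleftrightarrow> Q 0 \<and> (\<forall>i\<in>{1..m}. Q i)" for Q
    by (metis Suc_leI One_nat_def atLeastAtMost_iff le0 neq0_conv)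
  have "(\<forall>i\<le>m. pole_bound (\<Delta> i) u (homog_exp m v i - of_bool (i = 0))) \<longleftrightarrow>
     (\<forall>x\<in>\<Delta> 0. 0 \<le> pairing x (rat_vec u) + (- (\<Sum>i\<in>{1..m}. lookup (rat_vec v) i) - 1)) \<and>
     (\<forall>i\<in>{1..m}. \<forall>x\<in>\<Delta> i. 0 \<le> pairing x (rat_vec u) + lookup (rat_vec v) i)"
    unfolding all by (simp add: pole_bound_def homog_exp_def)
  then show ?thesis
    by (auto simp: lattice_points_def polyP_def uminus_poly_eval_le_iff le_poly_eval_minus_one_iff
        dual_cone_def rat_vec_vecs)
qed

text \<open>
  Multiplying a monomial of degree \<open>-1\<close> with any variable \<open>y\<^sub>i\<close> leads back to degree \<open>0\<close>.
\<close>

lemma lattP_var_exp: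
  assumes "(u, v) \<in> lattP d m \<sigma> \<Delta>" "i \<le> m"
  shows "(u, v + var_exp i) \<in> lattC d m \<sigma> \<Delta>"
proof -
  have "v + var_exp i \<in> vecs {1..m}"
    using assms var_exp_vecs[OF assms(2)] by (auto simp: lattP_iff intro: vecs_add)
  then show ?thesis
    using assms unfolding lattP_iff lattC_iff
    by (auto simp: homog_exp_add homog_exp_var_exp elim!: pole_bound_mono)
qed

lemma submonoid_lattC: "submonoid (lattC d m \<sigma> \<Delta>)"
proof -
  have "(0, 0) \<in> lattC d m \<sigma> \<Delta>"
    unfolding lattC_iff by (auto simp: pole_bound_def homog_exp_def pairing_def)
  moreover have "(u + u', v + v') \<in> lattC d m \<sigma> \<Delta>"
    if "(u, v) \<in> lattC d m \<sigma> \<Delta>" "(u', v') \<in> lattC d m \<sigma> \<Delta>" for u u' v v'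
    using that unfolding lattC_iff
    by (auto simp: homog_exp_add rat_vec_add pairing_add_right intro!: vecs_add pole_bound_add)
  ultimately show ?thesis by (auto simp: submonoid_def zero_prod_def)
qed


section \<open>The ideal of the line in the toric coordinate ring\<close>

lemma times_chi_eq: "times_chi f u = pushforward (Pair u) f"
  by (simp add: times_chi_def pushforward_def)

lemma to_algC_eq: "to_algC F = pushforward monomial_degree F"
  by (simp add: to_algC_def pushforward_def)

lemma times_chi_shift: "times_chi (g * single v 1) u = pushforward (\<lambda>e. (u, v + e)) g"
proof -
  have "times_chi (g * single v 1) u = single (0, 0) 1 * pushforward (\<lambda>e. (u, v + e)) g"
    unfolding times_chi_eq mult.commute[of g] by (rule pushforward_single_mult) simp
  then show ?thesis by (simp add: zero_prod_def[symmetric])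
qed

abbreviation fiber :: "zvec \<Rightarrow> (zvec \<times> zvec \<Rightarrow>\<^sub>0 'k::zero) \<Rightarrow> zvec \<Rightarrow>\<^sub>0 'k" where
  "fiber u \<equiv> Poly_Mapping.map_key (Pair u)"

lemma lookup_fiber [simp]: "lookup (fiber u \<phi>) v = lookup \<phi> (u, v)"
  by (simp add: map_key.rep_eq inj_def)

lemma keys_fiber: "v \<in> keys (fiber u \<phi>) \<longleftrightarrow> (u, v) \<in> keys \<phi>"
  by (simp add: in_keys_iff)

lemma lookup_times_chi: "lookup (times_chi f u) (u', v) = (if u = u' then lookup f v else 0)"
proof (cases "u = u'")
  case True
  then show ?thesis
    unfolding times_chi_eq using lookup_pushforward_inj[of "Pair u" v f] by (simp add: inj_on_def)
next
  case False
  then have "(u', v) \<notin> keys (times_chi f u)"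
    using keys_pushforward[of "Pair u" f] by (auto simp: times_chi_eq)
  then show ?thesis using False by (simp add: in_keys_iff)
qed

lemma sum_times_chi_fiber: "(\<Sum>u\<in>fst ` keys \<phi>. times_chi (fiber u \<phi>) u) = \<phi>"
proof (rule poly_mapping_eqI)
  fix p :: "zvec \<times> zvec"
  obtain u v where p: "p = (u, v)" by (cases p)
  have "u \<in> fst ` keys \<phi>" if "lookup \<phi> (u, v) \<noteq> 0"
    using that by (metis fst_conv image_eqI in_keys_iff)
  then show "lookup (\<Sum>u\<in>fst ` keys \<phi>. times_chi (fiber u \<phi>) u) p = lookup \<phi> p"
    by (auto simp: p lookup_sum lookup_times_chi sum.delta)
qed

lemma times_chi_ideal_tilde:
  assumes "u \<in> vecs {1..d}" "f \<in> line_ideal m L" "times_chi f u \<in> algC d m \<sigma> \<Delta>"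
  shows "times_chi f u \<in> ideal_tilde d m \<sigma> \<Delta> L"
proof -
  have "times_chi f u \<in> {times_chi f u |f u.
      u \<in> vecs {1..d} \<and> f \<in> line_ideal m L \<and> times_chi f u \<in> algC d m \<sigma> \<Delta>}"
    using assms by blast
  then show ?thesis
    unfolding ideal_tilde_def algC_eq by (rule subsetD[OF ideal_gen_superset[OF submonoid_lattC]])
qed

context torus_line
begin

definition vanishing :: "nat \<Rightarrow> qvec set \<Rightarrow> (nat \<Rightarrow> qvec set) \<Rightarrow> (zvec \<times> zvec \<Rightarrow>\<^sub>0 'k) set" where
  "vanishing d \<sigma> \<Delta> = {\<phi> \<in> algC d m \<sigma> \<Delta>. \<forall>u. fiber u \<phi> \<in> line_ideal m L}"

lemma vanishing_iff:
  assumes "\<phi> \<in> algC d m \<sigma> \<Delta>"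
  shows "\<phi> \<in> vanishing d \<sigma> \<Delta> \<longleftrightarrow> restrict_to_line m L \<phi> = (\<lambda>u z. 0)"
proof -
  have "fiber u \<phi> \<in> laurent_ring {1..m}" for u
    using assms by (auto simp: laurent_ring_def algC_def keys_fiber lattC_iff dest!: subsetD)
  then show ?thesis
    using assms by (auto simp: vanishing_def line_ideal_def restrict_to_line_def fun_eq_iff)
qed

lemma vanishing_is_ideal: "is_ideal (algC d m \<sigma> \<Delta>) (vanishing d \<sigma> \<Delta>)"
  unfolding algC_eq
proof (rule is_idealI)
  show "0 \<in> vanishing d \<sigma> \<Delta>"
  proof -
    have "fiber u 0 = (0 :: (nat, 'k) laurent)" for u by (rule poly_mapping_eqI) simp
    then show ?thesis using is_idealD(1)[OF line_ideal_is_ideal] by (simp add: vanishing_def algC_eq)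
  qed
next
  fix x y assume "x \<in> vanishing d \<sigma> \<Delta>" "y \<in> vanishing d \<sigma> \<Delta>"
  moreover have "fiber u (x + y) = fiber u x + fiber u y" for u
    by (rule poly_mapping_eqI) (simp add: lookup_add)
  ultimately show "x + y \<in> vanishing d \<sigma> \<Delta>"
    by (auto simp: vanishing_def algC_eq intro: supported_add is_idealD(2)[OF line_ideal_is_ideal])
next
  fix a c x assume a: "a \<in> lattC d m \<sigma> \<Delta>" and x: "x \<in> vanishing d \<sigma> \<Delta>"
  obtain u0 v0 where uv: "a = (u0, v0)" by (cases a)
  have v0: "v0 \<in> vecs {1..m}" using a by (simp add: uv lattC_iff)
  have "fiber u (single a c * x) = single v0 c * fiber (u - u0) x" for u
    by (rule poly_mapping_eqI) (simp add: uv)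
  moreover have "single v0 c * fiber (u - u0) x \<in> line_ideal m L" for u
    using x v0 by (intro is_idealD(3)[OF line_ideal_is_ideal])
      (auto simp: vanishing_def laurent_ring_eq supported_single)
  moreover have "single a c * x \<in> algC d m \<sigma> \<Delta>"
    using a x unfolding algC_eq vanishing_def
    by (intro supported_mult submonoid_lattC supported_single) auto
  ultimately show "single a c * x \<in> vanishing d \<sigma> \<Delta>" by (simp add: vanishing_def)
qed

text \<open>
  Vanishing is tested in each degree \<open>u\<close> separately, and the graded pieces of an element of the kernel
  of \<open>A(C) \<rightarrow> A(L)\<close> are among the given generators of the ideal.
\<close>

lemma ideal_tilde_eq_vanishing: "ideal_tilde d m \<sigma> \<Delta> L = vanishing d \<sigma> \<Delta>"
proof
  have "times_chi f u \<in> vanishing d \<sigma> \<Delta>" if "f \<in> line_ideal m L" "times_chi f u \<in> algC d m \<sigma> \<Delta>" for f u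
  proof -
    have "fiber u' (times_chi f u) = (if u = u' then f else 0)" for u'
      by (rule poly_mapping_eqI) (simp add: lookup_times_chi)
    then show ?thesis
      using that is_idealD(1)[OF line_ideal_is_ideal] by (auto simp: vanishing_def)
  qed
  then show "ideal_tilde d m \<sigma> \<Delta> L \<subseteq> vanishing d \<sigma> \<Delta>"
    unfolding ideal_tilde_def by (intro ideal_gen_least vanishing_is_ideal) auto
next
  show "vanishing d \<sigma> \<Delta> \<subseteq> ideal_tilde d m \<sigma> \<Delta> L"
  proof
    fix \<phi> assume \<phi>: "\<phi> \<in> vanishing d \<sigma> \<Delta>"
    have "times_chi (fiber u \<phi>) u \<in> ideal_tilde d m \<sigma> \<Delta> L" if u: "u \<in> fst ` keys \<phi>" for u
    proof -
      have "u \<in> vecs {1..d}"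
        using u \<phi> by (auto simp: vanishing_def algC_def lattC_iff dest!: subsetD)
      moreover have "times_chi (fiber u \<phi>) u \<in> algC d m \<sigma> \<Delta>"
        using \<phi> by (auto simp: vanishing_def algC_def in_keys_iff lookup_times_chi subset_eq split: if_splits)
      moreover have "fiber u \<phi> \<in> line_ideal m L" using \<phi> by (simp add: vanishing_def)
      ultimately show ?thesis by (intro times_chi_ideal_tilde)
    qed
    then have "(\<Sum>u\<in>fst ` keys \<phi>. times_chi (fiber u \<phi>) u) \<in> ideal_tilde d m \<sigma> \<Delta> L"
      unfolding ideal_tilde_def algC_eq by (intro is_ideal_sum[OF ideal_gen_is_ideal[OF submonoid_lattC]])
    then show "\<phi> \<in> ideal_tilde d m \<sigma> \<Delta> L" by (simp add: sum_times_chi_fiber)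
  qed
qed

text \<open>
  The pole conditions in degree \<open>u\<close> are lower bounds on homogeneous exponents, met by every term of \<open>f\<close>
  and hence by the minimum \<open>a j\<close> over these terms.  A monomial of degree \<open>-1\<close> with exponents at least
  \<open>a j\<close> is therefore a point of \<open>P\<close>.
\<close>

lemma graded_piece_induct:
  assumes f: "f \<in> line_ideal m L" "f \<noteq> 0" "\<forall>v\<in>keys f. (u, v) \<in> lattC d m \<sigma> \<Delta>"
    and S: "0 \<in> S" "\<And>x y. x \<in> S \<Longrightarrow> y \<in> S \<Longrightarrow> x + y \<in> S"
    and gen: "\<And>i v k. i \<in> {1..m} \<Longrightarrow> (u, v) \<in> lattP d m \<sigma> \<Delta> \<Longrightarrow> single v k * rel_form i \<in> S"
  shows "f \<in> S"
proof -
  define a where "a j = Min ((\<lambda>v. homog_exp m v j) ` keys f)" for j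
  have ne: "keys f \<noteq> {}" using f(2) by simp
  have le: "a j \<le> homog_exp m v j" if "v \<in> keys f" for v j
    using that by (auto simp: a_def)
  have attained: "\<exists>v\<in>keys f. a j = homog_exp m v j" for j
  proof -
    have "a j \<in> (\<lambda>v. homog_exp m v j) ` keys f"
      unfolding a_def using ne by (intro Min_in) auto
    then show ?thesis by blast
  qed
  have bound: "pole_bound (\<Delta> j) u (a j)" if "j \<le> m" for j
  proof -
    obtain v where v: "v \<in> keys f" "a j = homog_exp m v j" using attained by blast
    then have "(u, v) \<in> lattC d m \<sigma> \<Delta>" using f(3) by blast
    then show ?thesis using that v(2) unfolding lattC_iff by simp
  qed
  obtain v0 where "v0 \<in> keys f" using ne by blast
  then have "(u, v0) \<in> lattC d m \<sigma> \<Delta>" using f(3) by blast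
  then have u: "u \<in> vecs {1..d}" "\<forall>x\<in>\<sigma>. 0 \<le> pairing x (rat_vec u)" by (auto simp: lattC_iff)
  show ?thesis
  proof (rule line_ideal_induct[OF f(1) _ S])
    show "\<forall>v\<in>keys f. \<forall>j\<le>m. a j \<le> homog_exp m v j" using le by blast
    fix i v k assume i: "i \<in> {1..m}" and v: "v \<in> vecs {1..m}"
      "\<forall>j\<le>m. a j \<le> homog_exp m v j - of_bool (j = 0)"
    have "pole_bound (\<Delta> j) u (homog_exp m v j - of_bool (j = 0))" if "j \<le> m" for j
      using pole_bound_mono[OF bound[OF that]] v(2) that by blast
    then have "(u, v) \<in> lattP d m \<sigma> \<Delta>"
      using u v unfolding lattP_iff by blast
    then show "single v k * rel_form i \<in> S" using gen i by blast
  qed auto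
qed

text \<open>
  Without points of \<open>P\<close> in degree \<open>u\<close> there would be nothing to span the graded piece.
\<close>

lemma lattP_nonempty:
  assumes "f \<in> line_ideal m L" "f \<noteq> 0" "\<forall>v\<in>keys f. (u, v) \<in> lattC d m \<sigma> \<Delta>"
  shows "\<exists>v. (u, v) \<in> lattP d m \<sigma> \<Delta>"
proof (rule ccontr)
  assume "\<not> ?thesis"
  then have "f \<in> {0}" by (intro graded_piece_induct[OF assms]) auto
  with assms(2) show False by simp
qed

lemma tilde_generators_algC:
  assumes lin: "\<forall>g\<in>G. \<exists>c. g = dehom_linear_form m c" and P: "Ps \<subseteq> lattP d m \<sigma> \<Delta>"
  shows "tilde_generators G Ps \<subseteq> (algC d m \<sigma> \<Delta> :: (zvec \<times> zvec \<Rightarrow>\<^sub>0 'k) set)"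
proof
  fix \<phi> :: "zvec \<times> zvec \<Rightarrow>\<^sub>0 'k" assume "\<phi> \<in> tilde_generators G Ps"
  then obtain g u v where g: "g \<in> G" "(u, v) \<in> Ps" "\<phi> = times_chi (g * single v 1) u"
    by (auto simp: tilde_generators_def)
  obtain c where c: "g = dehom_linear_form m c" using lin g(1) by blast
  have "keys \<phi> \<subseteq> (\<lambda>e. (u, v + e)) ` keys g"
    unfolding g(3) times_chi_shift by (rule keys_pushforward)
  also have "\<dots> \<subseteq> lattC d m \<sigma> \<Delta>"
    using lattP_var_exp g(2) P by (auto simp: c keys_dehom_linear_form)
  finally show "\<phi> \<in> algC d m \<sigma> \<Delta>" by (simp add: algC_def)
qed

text \<open>
  A multiple \<open>l z\<^sup>v \<chi>\<^sup>u\<close> of a relation, \<open>(u, v) \<in> P\<close>, is expanded in two ways: \<open>l\<close> as a linear combination of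
  \<open>G\<close>, and \<open>(u, v)\<close> as the sum of a module generator and a lattice point of the dual cone.
\<close>

lemma tilde_generators_generate:
  assumes basis: "tropical_basis {1..m} (line_ideal m L) G"
    and lin: "\<forall>g\<in>G. \<exists>c. g = dehom_linear_form m c"
    and P: "module_generators d m \<sigma> \<Delta> Ps"
  shows "ideal_gen (algC d m \<sigma> \<Delta>) (tilde_generators G Ps) = ideal_tilde d m \<sigma> \<Delta> L"
proof
  let ?I = "ideal_gen (algC d m \<sigma> \<Delta>) (tilde_generators G Ps)"
  have I: "is_ideal (algC d m \<sigma> \<Delta>) ?I" "tilde_generators G Ps \<subseteq> ?I"
    unfolding algC_eq by (rule ideal_gen_is_ideal ideal_gen_superset submonoid_lattC)+
  have PsP: "Ps \<subseteq> lattP d m \<sigma> \<Delta>" using P by (simp add: module_generators_def)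
  show "?I \<subseteq> ideal_tilde d m \<sigma> \<Delta> L"
    unfolding ideal_tilde_eq_vanishing
  proof (intro ideal_gen_least vanishing_is_ideal subsetI)
    fix \<phi> assume \<phi>: "\<phi> \<in> tilde_generators G Ps"
    then obtain g u v where g: "g \<in> G" "(u, v) \<in> Ps" "\<phi> = times_chi (g * single v 1) u"
      by (auto simp: tilde_generators_def)
    have uv: "u \<in> vecs {1..d}" "v \<in> vecs {1..m}" using g(2) PsP by (auto simp: lattP_iff)
    have "g \<in> line_ideal m L" using basis g(1) by (auto simp: tropical_basis_def)
    then have "single v 1 * g \<in> line_ideal m L"
      using uv by (intro is_idealD(3)[OF line_ideal_is_ideal]) (auto simp: laurent_ring_eq supported_single)
    moreover have "\<phi> \<in> algC d m \<sigma> \<Delta>" using \<phi> tilde_generators_algC[OF lin PsP] by blast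
    ultimately have "\<phi> \<in> ideal_tilde d m \<sigma> \<Delta> L"
      using uv(1) unfolding g(3) by (intro times_chi_ideal_tilde) (simp_all add: mult.commute)
    then show "\<phi> \<in> vanishing d \<sigma> \<Delta>" by (simp add: ideal_tilde_eq_vanishing)
  qed
  show "ideal_tilde d m \<sigma> \<Delta> L \<subseteq> ?I"
    unfolding ideal_tilde_def
  proof (intro ideal_gen_least I subsetI)
    fix \<phi> assume "\<phi> \<in> {times_chi f u |f u. u \<in> vecs {1..d} \<and> f \<in> line_ideal m L \<and> times_chi f u \<in> algC d m \<sigma> \<Delta>}"
    then obtain f u where f: "\<phi> = times_chi f u" "f \<in> line_ideal m L" "times_chi f u \<in> algC d m \<sigma> \<Delta>" by blast
    have keys_f: "\<forall>v\<in>keys f. (u, v) \<in> lattC d m \<sigma> \<Delta>"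
    proof
      fix v assume "v \<in> keys f"
      then have "(u, v) \<in> keys (times_chi f u)" by (simp add: in_keys_iff lookup_times_chi)
      then show "(u, v) \<in> lattC d m \<sigma> \<Delta>" using f(3) by (auto simp: algC_def)
    qed
    show "\<phi> \<in> ?I"
    proof (cases "f = 0")
      case True
      then show ?thesis using is_idealD(1)[OF I(1)] by (simp add: f(1) times_chi_eq)
    next
      case False
      have "f \<in> {f. times_chi f u \<in> ?I}"
      proof (rule graded_piece_induct[OF f(2) False keys_f])
        fix i v k assume i: "i \<in> {1..m}" and v: "(u, v) \<in> lattP d m \<sigma> \<Delta>"
        obtain pu pv cu cv where pc: "(pu, pv) \<in> Ps" "(cu, cv) \<in> lattC d m \<sigma> \<Delta>" "u = cu + pu" "v = cv + pv"
          using P v unfolding module_generators_def by (auto simp: add.commute dest!: bspec)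
        obtain F \<kappa> where F: "finite F" "F \<subseteq> G" "rel_form i = (\<Sum>g\<in>F. single 0 (\<kappa> g) * g)"
          using rel_form_in_span[OF basis lin i] by blast
        have "times_chi (single v k * rel_form i) u = (\<Sum>g\<in>F. times_chi (single v (k * \<kappa> g) * g) u)"
          by (simp add: F(3) sum_distrib_left mult.assoc[symmetric] Poly_Mapping.mult_single
              times_chi_eq pushforward_sum)
        also have "\<dots> \<in> ?I"
        proof (rule is_ideal_sum[OF I(1)])
          fix g assume "g \<in> F"
          then have "times_chi (g * single pv 1) pu \<in> tilde_generators G Ps"
            using F(2) pc(1) unfolding tilde_generators_def by blast
          then have "times_chi (g * single pv 1) pu \<in> ?I" using I(2) by blast
          then have "single (cu, cv) (k * \<kappa> g) * times_chi (g * single pv 1) pu \<in> ?I"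
            using pc(2) by (intro is_idealD(3)[OF I(1)]) (auto simp: algC_eq supported_single)
          also have "single (cu, cv) (k * \<kappa> g) * times_chi (g * single pv 1) pu =
              times_chi (single v (k * \<kappa> g) * g) u"
            unfolding times_chi_shift unfolding times_chi_eq pc(3,4)
            by (rule pushforward_single_mult[symmetric]) (simp add: add.assoc)
          finally show "times_chi (single v (k * \<kappa> g) * g) u \<in> ?I" .
        qed
        finally show "single v k * rel_form i \<in> {f. times_chi f u \<in> ?I}" by simp
      qed (auto simp: times_chi_eq pushforward_add intro: is_idealD[OF I(1)])
      then show ?thesis by (simp add: f(1))
    qed
  qed
qed

end


section \<open>Lifting to the polynomial ring\<close>

lemma monomial_degree_add: "monomial_degree (a + b) = monomial_degree a + monomial_degree b"
  by (simp add: monomial_degree_def frag_extend_add)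

lemma to_algC_mult: "to_algC (F * F') = to_algC F * to_algC F'"
  unfolding to_algC_eq by (rule pushforward_mult) (rule monomial_degree_add)

lemma to_algC_add: "to_algC (F + F') = to_algC F + to_algC F'"
  by (simp add: to_algC_eq pushforward_add)

lemma to_algC_diff: "to_algC (F - F') = to_algC F - to_algC F'"
  by (simp add: to_algC_eq pushforward_diff)

lemma to_algC_sum: "to_algC (\<Sum>x\<in>A. f x) = (\<Sum>x\<in>A. to_algC (f x))"
  by (simp add: to_algC_eq pushforward_sum)

lemma toric_ideal_is_ideal: "is_ideal (poly_ring H) (toric_ideal H)"
  unfolding is_ideal_def toric_ideal_def poly_ring_eq
  using supported_is_ideal[OF submonoid_nonneg, of H]
  by (auto simp: to_algC_mult to_algC_add is_ideal_def) (auto simp: to_algC_eq)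

lemma poly_ring_laurent_ring: "poly_ring H \<subseteq> laurent_ring H"
  by (auto simp: poly_ring_def laurent_ring_def nonneg_exps_def)

lemma idealJ_torus_is_ideal: "is_ideal (laurent_ring H) (idealJ_torus m H L)"
  unfolding idealJ_torus_def by (rule laurent_is_ideal)

lemma idealJ_subset_torus: "idealJ m H L \<subseteq> idealJ_torus m H L"
  unfolding idealJ_torus_def laurent_ring_eq by (rule ideal_gen_superset[OF submonoid_vecs])

text \<open>
  The elements that reach \<open>J(L)\<close> after multiplication with a monomial of \<open>S\<close> form an ideal of the
  Laurent polynomial ring, because denominators can be multiplied.
\<close>

lemma idealJ_torus_clear_denominators:
  assumes J: "is_ideal (poly_ring H) (idealJ m H L)" and f: "f \<in> idealJ_torus m H L"
  shows "\<exists>b. single b 1 * f \<in> idealJ m H L"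
proof -
  define Q where "Q = {f. \<exists>b\<in>nonneg_exps H. single b 1 * f \<in> idealJ m H L}"
  have mult: "single e c * x \<in> idealJ m H L" if "e \<in> nonneg_exps H" "x \<in> idealJ m H L" for e c x
    using that by (intro is_idealD(3)[OF J]) (auto simp: poly_ring_eq supported_single)
  have "is_ideal (supported (vecs H)) Q"
  proof (rule is_idealI)
    show "0 \<in> Q"
      using is_idealD(1)[OF J] submonoid_nonneg[of H] by (auto simp: Q_def submonoid_def)
  next
    fix x y assume "x \<in> Q" "y \<in> Q"
    then obtain b1 b2 where b1: "b1 \<in> nonneg_exps H" "single b1 1 * x \<in> idealJ m H L"
      and b2: "b2 \<in> nonneg_exps H" "single b2 1 * y \<in> idealJ m H L"
      by (auto simp: Q_def)
    have "single (b1 + b2) 1 * (x + y) = single b2 1 * (single b1 1 * x) + single b1 1 * (single b2 1 * y)"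
      by (simp add: distrib_left mult.assoc[symmetric] Poly_Mapping.mult_single add.commute)
    also have "\<dots> \<in> idealJ m H L" by (intro is_idealD(2)[OF J] mult b1 b2)
    finally show "x + y \<in> Q"
      using b1(1) b2(1) submonoid_nonneg[of H] by (auto simp: Q_def submonoid_def)
  next
    fix e :: "zvec \<times> zvec \<Rightarrow>\<^sub>0 int" and c and x assume e: "e \<in> vecs H" and "x \<in> Q"
    then obtain b where b: "b \<in> nonneg_exps H" "single b 1 * x \<in> idealJ m H L"
      by (auto simp: Q_def)
    \<comment> \<open>The negative part of \<open>e\<close>, which clears its denominator.\<close>
    define n where "n = Poly_Mapping.map (\<lambda>i. max 0 (- i)) e"
    have n: "lookup n i = max 0 (- lookup e i)" for i
      by (simp add: n_def map.rep_eq when_def)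
    have "n \<in> nonneg_exps H" "e + n \<in> nonneg_exps H"
      using e by (auto simp: nonneg_exps_def n vecs_def in_keys_iff lookup_add subset_eq)
    moreover have "single (b + n) 1 * (single e c * x) = single (e + n) c * (single b 1 * x)"
      by (simp add: mult.assoc[symmetric] Poly_Mapping.mult_single ac_simps)
    moreover have "single (e + n) c * (single b 1 * x) \<in> idealJ m H L"
      using calculation by (intro mult b)
    moreover have "b + n \<in> nonneg_exps H"
      using b(1) calculation submonoid_nonneg[of H] by (auto simp: submonoid_def)
    ultimately show "single e c * x \<in> Q"
      unfolding Q_def mem_Collect_eq by (intro bexI[of _ "b + n"]) simp_all
  qed
  moreover have "idealJ m H L \<subseteq> Q"
    using submonoid_nonneg[of H] by (auto simp: Q_def submonoid_def intro!: bexI[of _ 0])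
  ultimately have "idealJ_torus m H L \<subseteq> Q"
    unfolding idealJ_torus_def laurent_ring_eq by (rule ideal_gen_least)
  with f show ?thesis by (auto simp: Q_def)
qed

lemma unique_min_shift:
  fixes f :: "('i, 'k::comm_ring_1) laurent"
  assumes "unique_min w f a"
  shows "unique_min w (single b 1 * f) (b + a)"
proof -
  have keys: "k \<in> keys (single b 1 * f) \<longleftrightarrow> k - b \<in> keys f" for k by (simp add: in_keys_iff)
  have "weight w (b + a) < weight w k" if "k - b \<in> keys f" "k \<noteq> b + a" for k
  proof -
    have "k - b \<noteq> a" using that(2) by auto
    then have "weight w a < weight w (k - b)" using assms that(1) by (auto simp: unique_min_def)
    then show ?thesis by (simp add: weight_diff weight_add)
  qed
  then show ?thesis using assms by (auto simp: unique_min_def keys)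
qed

text \<open>
  A generating set of binomials without strictly minimal term consists of binomials that are
  homogeneous for the finer grading by monomial degree and weight.  Hence so is the whole toric
  ideal, and the weight of an exponent depends on its degree only.
\<close>

lemma weight_determined_by_degree:
  fixes T :: "(zvec \<times> zvec, 'k::field) laurent set"
  assumes T: "T \<subseteq> binomials H" "ideal_gen (poly_ring H) T = toric_ideal H"
    and no_min: "\<And>F a. F \<in> T \<Longrightarrow> \<not> unique_min w F a"
    and ab: "a \<in> nonneg_exps H" "b \<in> nonneg_exps H" "monomial_degree a = monomial_degree b"
  shows "weight w a = weight w b"
proof -
  define N :: "(zvec \<times> zvec, 'k) laurent set" where
    "N = {F. \<forall>p s. lin_ext (\<lambda>a. of_bool (monomial_degree a = p \<and> weight w a = s)) F = 0}"
  have "is_ideal (poly_ring H) N"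
    unfolding poly_ring_eq
  proof (rule is_idealI)
    fix e c and x assume x: "x \<in> N"
    have shift: "monomial_degree (e + a) = p \<and> weight w (e + a) = s \<longleftrightarrow>
        monomial_degree a = p - monomial_degree e \<and> weight w a = s - weight w e" for a p s
      by (auto simp: monomial_degree_add weight_add)
    show "single e c * x \<in> N"
      unfolding N_def mem_Collect_eq
    proof (intro allI)
      fix p s
      have "lin_ext (\<lambda>a. of_bool (monomial_degree a = p - monomial_degree e \<and> weight w a = s - weight w e)) x = 0"
        using x unfolding N_def by blast
      then show "lin_ext (\<lambda>a. of_bool (monomial_degree a = p \<and> weight w a = s)) (single e c * x) = 0"
        by (simp only: lin_ext_single_mult shift mult_zero_right)
    qed
  qed (auto simp: N_def lin_ext_add)
  moreover have "T \<subseteq> N"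
  proof
    fix F assume F: "F \<in> T"
    obtain a b where F_eq: "F = single a 1 - single b 1" using F T(1) by (auto simp: binomials_def)
    have "F \<in> toric_ideal H"
      using F T(2) ideal_gen_superset[OF submonoid_nonneg, of T H] by (auto simp: poly_ring_eq)
    then have "single (monomial_degree a) (1 :: 'k) = single (monomial_degree b) 1"
      by (simp add: toric_ideal_def F_eq to_algC_diff) (simp add: to_algC_eq)
    then have deg: "monomial_degree a = monomial_degree b"
      by (metis lookup_single_eq lookup_single_not_eq zero_neq_one)
    have "weight w a = weight w b"
    proof (rule ccontr)
      assume ne: "weight w a \<noteq> weight w b"
      then have "a \<noteq> b" by auto
      then have "keys F = {a, b}" by (auto simp: F_eq in_keys_iff lookup_minus lookup_single when_def split: if_splits)
      then have "unique_min w F a \<or> unique_min w F b"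
        using ne by (auto simp: unique_min_def)
      then show False using no_min[OF F] by blast
    qed
    then show "F \<in> N" using deg by (simp add: N_def F_eq lin_ext_diff)
  qed
  ultimately have "toric_ideal H \<subseteq> N" unfolding T(2)[symmetric] by (rule ideal_gen_least)
  moreover have "single a 1 - single b 1 \<in> toric_ideal H"
    using ab unfolding toric_ideal_def poly_ring_eq
    by (auto simp: to_algC_diff intro!: supported_diff supported_single) (simp add: to_algC_eq)
  ultimately have "lin_ext (\<lambda>x. of_bool (monomial_degree x = monomial_degree a \<and> weight w x = weight w a))
      (single a (1 :: 'k) - single b 1) = 0"
    unfolding N_def by blast
  then show ?thesis using ab(3) by (auto simp: lin_ext_diff of_bool_def split: if_splits)
qed

locale embedded_line = torus_line m b t r L
  for m b :: nat and t r :: "nat \<Rightarrow> 'k::field" and L :: "(nat \<Rightarrow> 'k) set" +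
  fixes d :: nat and \<sigma> :: "qvec set" and \<Delta> :: "nat \<Rightarrow> qvec set" and H Ps :: "(zvec \<times> zvec) set"
    and G :: "(nat, 'k) laurent set"
  assumes H: "monoid_generators d m \<sigma> \<Delta> H"
    and Ps: "module_generators d m \<sigma> \<Delta> Ps"
    and basis: "tropical_basis {1..m} (line_ideal m L) G"
    and lin: "\<forall>g\<in>G. \<exists>c. g = dehom_linear_form m c"
begin

abbreviation "C \<equiv> lattC d m \<sigma> \<Delta>"
abbreviation "gens \<equiv> tilde_generators G Ps"

lemma Ps_lattP: "Ps \<subseteq> lattP d m \<sigma> \<Delta>"
  using Ps by (simp add: module_generators_def)

lemma gens_algC: "gens \<subseteq> algC d m \<sigma> \<Delta>"
  by (rule tilde_generators_algC[OF lin Ps_lattP])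

lemma gens_generate: "ideal_gen (algC d m \<sigma> \<Delta>) gens = vanishing d \<sigma> \<Delta>"
  using tilde_generators_generate[OF basis lin Ps] by (simp add: ideal_tilde_eq_vanishing)

lemma degree_nonneg: "a \<in> nonneg_exps H \<Longrightarrow> monomial_degree a \<in> C"
  using H by (auto simp: monoid_generators_def)

definition lift_exp :: "zvec \<times> zvec \<Rightarrow> (zvec \<times> zvec \<Rightarrow>\<^sub>0 int)" where
  "lift_exp p = (SOME a. a \<in> nonneg_exps H \<and> monomial_degree a = p)"

lemma lift_exp:
  assumes "p \<in> C"
  shows "lift_exp p \<in> nonneg_exps H" "monomial_degree (lift_exp p) = p"
proof -
  have "p \<in> monomial_degree ` nonneg_exps H"
    using assms H by (simp add: monoid_generators_def)
  then have "\<exists>a. a \<in> nonneg_exps H \<and> monomial_degree a = p" by (metis imageE)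
  then have "lift_exp p \<in> nonneg_exps H \<and> monomial_degree (lift_exp p) = p"
    unfolding lift_exp_def by (rule someI_ex)
  then show "lift_exp p \<in> nonneg_exps H" "monomial_degree (lift_exp p) = p" by auto
qed

lemma to_algC_in_algC:
  assumes "F \<in> poly_ring H"
  shows "to_algC F \<in> algC d m \<sigma> \<Delta>"
proof -
  have "monomial_degree ` keys F \<subseteq> C" using assms degree_nonneg by (auto simp: poly_ring_def)
  then show ?thesis
    unfolding to_algC_eq algC_def using keys_pushforward[of monomial_degree F] by simp
qed

text \<open>
  Choosing one exponent over each lattice point gives a lift that is injective on terms.
\<close>

lemma termwise_lift_exists:
  assumes "\<phi> \<in> algC d m \<sigma> \<Delta>"
  shows "\<exists>F\<in>poly_ring H. to_algC F = \<phi> \<and> termwise F"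
proof -
  let ?F = "pushforward lift_exp \<phi>"
  have keys: "keys ?F \<subseteq> lift_exp ` keys \<phi>" by (rule keys_pushforward)
  have "keys \<phi> \<subseteq> C" using assms by (simp add: algC_def)
  then have lift: "lift_exp p \<in> nonneg_exps H" "monomial_degree (lift_exp p) = p" if "p \<in> keys \<phi>" for p
    using lift_exp[of p] that by auto
  have "?F \<in> poly_ring H" using keys lift by (auto simp: poly_ring_def)
  moreover have "to_algC ?F = \<phi>"
    unfolding to_algC_eq pushforward_pushforward by (rule pushforward_ident) (rule lift)
  moreover have "inj_on monomial_degree (lift_exp ` keys \<phi>)" by (auto simp: inj_on_def lift(2))
  then have "termwise ?F" unfolding termwise_def using keys by (rule inj_on_subset)
  ultimately show ?thesis by blast
qed

lemma idealJ_iff: "F \<in> idealJ m H L \<longleftrightarrow> F \<in> poly_ring H \<and> to_algC F \<in> vanishing d \<sigma> \<Delta>"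
  using vanishing_iff[OF to_algC_in_algC] by (auto simp: idealJ_def)

lemma idealJ_is_ideal: "is_ideal (poly_ring H) (idealJ m H L)"
  unfolding is_ideal_def
proof (intro conjI ballI)
  have R: "is_ideal (poly_ring H) (poly_ring H :: (zvec \<times> zvec, 'k) laurent set)"
    unfolding poly_ring_eq by (rule supported_is_ideal[OF submonoid_nonneg])
  note V = vanishing_is_ideal[of d \<sigma> \<Delta>]
  show "0 \<in> idealJ m H L"
    using is_idealD(1)[OF R] is_idealD(1)[OF V] by (simp add: idealJ_iff to_algC_eq)
  fix x assume x: "x \<in> idealJ m H L"
  show "x + y \<in> idealJ m H L" if "y \<in> idealJ m H L" for y
    using x that is_idealD(2)[OF R] is_idealD(2)[OF V] by (simp add: idealJ_iff to_algC_add)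
  show "c * x \<in> idealJ m H L" if "c \<in> poly_ring H" for c
    using x that is_idealD(3)[OF R] is_idealD(3)[OF V to_algC_in_algC]
    by (simp add: idealJ_iff to_algC_mult)
qed

lemma toric_ideal_subset_idealJ: "toric_ideal H \<subseteq> idealJ m H L"
  using is_idealD(1)[OF vanishing_is_ideal[of d \<sigma> \<Delta>]] by (auto simp: toric_ideal_def idealJ_iff)

lemma lifts_subset_idealJ:
  assumes "lifts H gens \<Lambda>"
  shows "\<Lambda> \<subseteq> idealJ m H L"
proof
  fix F assume "F \<in> \<Lambda>"
  then have "F \<in> poly_ring H" "to_algC F \<in> gens" using assms by (auto simp: lifts_def)
  moreover have "gens \<subseteq> vanishing d \<sigma> \<Delta>"
    unfolding gens_generate[symmetric] algC_eq by (rule ideal_gen_superset[OF submonoid_lattC])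
  ultimately show "F \<in> idealJ m H L" by (auto simp: idealJ_iff)
qed

lemma generators_subset_idealJ:
  assumes "ideal_gen (poly_ring H) T = toric_ideal H" "lifts H gens \<Lambda>"
  shows "T \<union> \<Lambda> \<subseteq> idealJ m H L"
  using lifts_subset_idealJ[OF assms(2)] toric_ideal_subset_idealJ assms(1)
    ideal_gen_superset[OF submonoid_nonneg, of T H]
  by (auto simp: poly_ring_eq)

text \<open>
  The image in \<open>A(C)\<close> of an element of \<open>J(L)\<close> is a combination of the generators; lifting the combination
  changes the element by a member of the toric ideal.
\<close>

lemma lifts_generate_idealJ:
  assumes T: "ideal_gen (poly_ring H) T = toric_ideal H" and \<Lambda>: "lifts H gens \<Lambda>"
  shows "ideal_gen (poly_ring H) (T \<union> \<Lambda>) = idealJ m H L"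
proof
  let ?I = "ideal_gen (poly_ring H) (T \<union> \<Lambda>)"
  show "?I \<subseteq> idealJ m H L"
    by (intro ideal_gen_least idealJ_is_ideal generators_subset_idealJ assms)
  have I: "is_ideal (poly_ring H) ?I" "T \<union> \<Lambda> \<subseteq> ?I"
    unfolding poly_ring_eq by (rule ideal_gen_is_ideal ideal_gen_superset submonoid_nonneg)+
  have toric: "toric_ideal H \<subseteq> ?I"
    unfolding T[symmetric] using I by (intro ideal_gen_least) auto
  show "idealJ m H L \<subseteq> ?I"
  proof
    fix F assume F: "F \<in> idealJ m H L"
    then have "to_algC F \<in> ideal_gen (algC d m \<sigma> \<Delta>) gens" by (simp add: idealJ_iff gens_generate)
    then obtain A c where A: "to_algC F = (\<Sum>g\<in>A. c g * g)" "finite A" "A \<subseteq> gens" "\<forall>g\<in>A. c g \<in> algC d m \<sigma> \<Delta>"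
      unfolding ideal_gen_def mem_Collect_eq by blast
    have "\<forall>g\<in>A. \<exists>F\<in>poly_ring H. to_algC F = c g" using A(4) termwise_lift_exists by blast
    then obtain c' where c': "\<And>g. g \<in> A \<Longrightarrow> c' g \<in> poly_ring H" "\<And>g. g \<in> A \<Longrightarrow> to_algC (c' g) = c g" by metis
    have "A \<subseteq> to_algC ` \<Lambda>" using A(3) \<Lambda> by (simp add: lifts_def)
    then have "\<forall>g\<in>A. \<exists>F\<in>\<Lambda>. to_algC F = g" by (metis imageE subsetD)
    then obtain l where l: "\<And>g. g \<in> A \<Longrightarrow> l g \<in> \<Lambda>" "\<And>g. g \<in> A \<Longrightarrow> to_algC (l g) = g" by metis
    define F' where "F' = (\<Sum>g\<in>A. c' g * l g)"
    have F': "F' \<in> ?I"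
      unfolding F'_def using c'(1) l(1) I(2) by (intro is_ideal_sum[OF I(1)] is_idealD(3)[OF I(1)]) auto
    have "to_algC F' = to_algC F"
      by (simp add: F'_def A(1) to_algC_sum to_algC_mult c'(2) l(2))
    moreover have "F' \<in> poly_ring H"
      using F' \<open>?I \<subseteq> idealJ m H L\<close> by (auto simp: idealJ_iff)
    ultimately have "F - F' \<in> toric_ideal H"
      using F by (auto simp: toric_ideal_def to_algC_diff idealJ_iff poly_ring_eq intro: supported_diff)
    then have "(F - F') + F' \<in> ?I" using toric F' by (intro is_idealD(2)[OF I(1)]) auto
    then show "F \<in> ?I" by simp
  qed
qed

text \<open>
  Replacing each monomial by the chosen one of its degree changes a polynomial by a combination of
  binomials of the toric ideal.  For a member of the toric ideal, the replaced terms cancel.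
\<close>

lemma binomials_generate_toric_ideal:
  "ideal_gen (poly_ring H) (binomials H \<inter> toric_ideal H) = (toric_ideal H :: (zvec \<times> zvec, 'k) laurent set)"
proof
  let ?I = "ideal_gen (poly_ring H) (binomials H \<inter> toric_ideal H) :: (zvec \<times> zvec, 'k) laurent set"
  show "?I \<subseteq> toric_ideal H" by (intro ideal_gen_least toric_ideal_is_ideal) auto
  have I: "is_ideal (poly_ring H) ?I" "binomials H \<inter> toric_ideal H \<subseteq> ?I"
    unfolding poly_ring_eq by (rule ideal_gen_is_ideal ideal_gen_superset submonoid_nonneg)+
  show "toric_ideal H \<subseteq> ?I"
  proof
    fix F :: "(zvec \<times> zvec, 'k) laurent" assume F: "F \<in> toric_ideal H"
    then have keys: "keys F \<subseteq> nonneg_exps H" and "to_algC F = 0"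
      by (auto simp: toric_ideal_def poly_ring_def)
    define s where "s a = lift_exp (monomial_degree a)" for a
    have s: "s a \<in> nonneg_exps H" "monomial_degree (s a) = monomial_degree a" if "a \<in> keys F" for a
      using that keys by (auto simp: s_def intro!: lift_exp degree_nonneg)
    have "pushforward s F = pushforward lift_exp (to_algC F)"
      by (simp add: to_algC_eq pushforward_pushforward s_def[abs_def])
    then have "pushforward s F = 0" by (simp add: \<open>to_algC F = 0\<close>)
    then have "F = (\<Sum>a\<in>keys F. single a (lookup F a)) - (\<Sum>a\<in>keys F. single (s a) (lookup F a))"
      by (simp add: sum_single_keys pushforward_def)
    also have "\<dots> = (\<Sum>a\<in>keys F. single 0 (lookup F a) * (single a 1 - single (s a) 1))"
      by (simp add: sum_subtractf[symmetric] right_diff_distrib Poly_Mapping.mult_single)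
    also have "\<dots> \<in> ?I"
    proof (intro is_ideal_sum[OF I(1)] is_idealD(3)[OF I(1)])
      fix a assume a: "a \<in> keys F"
      show "single 0 (lookup F a) \<in> poly_ring H"
        using submonoid_nonneg[of H] by (auto simp: poly_ring_eq submonoid_def intro: supported_single)
      have "single a 1 - single (s a) 1 \<in> binomials H"
        using a keys s(1)[OF a] unfolding binomials_def by blast
      moreover have "single a (1 :: 'k) - single (s a) 1 \<in> toric_ideal H"
        using a keys s[OF a] unfolding toric_ideal_def poly_ring_eq
        by (auto simp: to_algC_diff intro!: supported_diff supported_single) (simp add: to_algC_eq)
      ultimately show "single a 1 - single (s a) 1 \<in> ?I" using I(2) by blast
    qed
    finally show "F \<in> ?I" .
  qed
qed

lemma termwise_lifts_exist: "\<exists>\<Lambda>. lifts H gens \<Lambda> \<and> (\<forall>F\<in>\<Lambda>. termwise F)"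
proof -
  have "\<forall>\<phi>\<in>gens. \<exists>F\<in>poly_ring H. to_algC F = \<phi> \<and> termwise F"
    using termwise_lift_exists gens_algC by blast
  then obtain l where "\<And>\<phi>. \<phi> \<in> gens \<Longrightarrow> l \<phi> \<in> poly_ring H \<and> to_algC (l \<phi>) = \<phi> \<and> termwise (l \<phi>)" by metis
  then have "lifts H gens (l ` gens) \<and> (\<forall>F\<in>l ` gens. termwise F)"
    by (auto simp: lifts_def image_iff)
  then show ?thesis by blast
qed

end


section \<open>The tropical basis\<close>

context embedded_line
begin

definition induced_weight :: "(zvec \<times> zvec \<Rightarrow> real) \<Rightarrow> zvec \<times> zvec \<Rightarrow> real" where
  "induced_weight w p = weight w (lift_exp p)"

text \<open>
  A weight that depends on the degree only is additive on the lattice points of the dual cone.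
  Its differences along the \<open>\<int>\<^sup>m\<close>-direction come from one weight on \<open>\<int>\<^sup>m\<close>: a lattice point
  \<open>(u0, v0)\<close> of the polyhedron and its translates by the exponents of the variables lie in the
  cone, so that they fix the value on each basis vector, and additivity gives the rest.
\<close>

lemma induced_weight_difference:
  assumes w: "\<And>a b. a \<in> nonneg_exps H \<Longrightarrow> b \<in> nonneg_exps H \<Longrightarrow>
      monomial_degree a = monomial_degree b \<Longrightarrow> weight w a = weight w b"
    and P: "(u0, v0) \<in> lattP d m \<sigma> \<Delta>"
  defines "w' \<equiv> \<lambda>i. if i \<in> {1..m} then
      induced_weight w (u0, v0 + var_exp i) - induced_weight w (u0, v0) else 0"
  assumes uv: "(u, v) \<in> C" "(u, v') \<in> C"
  shows "induced_weight w (u, v) - induced_weight w (u, v') = weight w' v - weight w' v'"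
proof -
  let ?\<omega> = "induced_weight w"
  have add: "?\<omega> (p + q) = ?\<omega> p + ?\<omega> q" if "p \<in> C" "q \<in> C" for p q
  proof -
    have pq: "p + q \<in> C" using that submonoid_lattC[of d m \<sigma> \<Delta>] by (simp add: submonoid_def)
    have "weight w (lift_exp (p + q)) = weight w (lift_exp p + lift_exp q)"
    proof (rule w)
      show "lift_exp p + lift_exp q \<in> nonneg_exps H"
        using lift_exp(1) that submonoid_nonneg[of H] by (simp add: submonoid_def)
    qed (simp_all add: lift_exp pq that monomial_degree_add)
    then show ?thesis by (simp add: induced_weight_def weight_add)
  qed
  have base: "(u0, v0 + var_exp i) \<in> C" if "i \<le> m" for i
    using P that by (rule lattP_var_exp)
  have base0: "(u0, v0) \<in> C" using base[of 0] by (simp add: var_exp_def)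
  define D where "D = {x. \<exists>p\<in>C. \<exists>q\<in>C. p = q + (0, x) \<and> ?\<omega> p - ?\<omega> q = weight w' x}"
  have "x \<in> D" if "keys x \<subseteq> {1..m}" for x
    using that
  proof (induction x rule: frag_induction)
    case zero
    show ?case using base0 unfolding D_def mem_Collect_eq
      by (intro bexI[of _ "(u0, v0)"]) (auto simp: zero_prod_def[symmetric])
  next
    case (one i)
    then have i: "i \<in> {1..m}" "single i 1 = var_exp i" by (auto simp: var_exp_def)
    have "weight w' (single i 1) = ?\<omega> (u0, v0 + var_exp i) - ?\<omega> (u0, v0)"
      using i(1) by (simp add: w'_def)
    then show ?case using base0 base[of i] i unfolding D_def mem_Collect_eq
      by (intro bexI[of _ "(u0, v0)"] bexI[of _ "(u0, v0 + var_exp i)"]) auto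
  next
    case (diff x y)
    obtain p q where p: "p \<in> C" "q \<in> C" "p = q + (0, x)" "?\<omega> p - ?\<omega> q = weight w' x"
      using diff(1) unfolding D_def by blast
    obtain p' q' where p': "p' \<in> C" "q' \<in> C" "p' = q' + (0, y)" "?\<omega> p' - ?\<omega> q' = weight w' y"
      using diff(2) unfolding D_def by blast
    have "p + q' = (q + p') + (0, x - y)" by (simp add: p(3) p'(3) prod_eq_iff)
    moreover have "?\<omega> (p + q') - ?\<omega> (q + p') = weight w' (x - y)"
      using p p' by (simp add: add weight_diff)
    moreover have "p + q' \<in> C" "q + p' \<in> C"
      using p p' submonoid_lattC[of d m \<sigma> \<Delta>] by (simp_all add: submonoid_def)
    ultimately show ?case unfolding D_def by blast
  qed
  moreover have "keys (v - v') \<subseteq> {1..m}"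
    using uv vecs_diff[of v "{1..m}" v'] by (simp add: lattC_iff vecs_def)
  ultimately have "v - v' \<in> D" by blast
  then obtain p q where p: "p \<in> C" "q \<in> C" "p = q + (0, v - v')" "?\<omega> p - ?\<omega> q = weight w' (v - v')"
    unfolding D_def by blast
  have "(u, v) + q = (u, v') + p" by (simp add: p(3) prod_eq_iff)
  then have "?\<omega> (u, v) + ?\<omega> q = ?\<omega> (u, v') + ?\<omega> p" using add uv p by metis
  then show ?thesis using p(4) by (simp add: weight_diff)
qed

text \<open>
  A strictly minimal term is carried from \<open>J(L)\<close> down to \<open>I(L)\<close>, from there to a member of \<open>G\<close>, and up
  again to its lift.  The passage down uses that the weight depends on the degree only: no term
  cancels against the minimal one.  The passage up uses that the lift is taken term by term.
\<close>

lemma tropical_basis_lifts: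
  assumes T: "T \<subseteq> binomials H" "ideal_gen (poly_ring H) T = toric_ideal H"
    and \<Lambda>: "lifts H gens \<Lambda>" "\<forall>F\<in>\<Lambda>. termwise F"
  shows "tropical_basis H (idealJ_torus m H L) (T \<union> \<Lambda>)"
proof -
  have sub: "T \<union> \<Lambda> \<subseteq> idealJ m H L" by (rule generators_subset_idealJ[OF T(2) \<Lambda>(1)])
  have J_laurent: "idealJ m H L \<subseteq> laurent_ring H"
    using poly_ring_laurent_ring[of H] by (auto simp: idealJ_iff)
  have "False" if w: "w \<in> real_vecs H"
      and trop: "\<forall>f\<in>T \<union> \<Lambda>. w \<in> trop H (ideal_gen (laurent_ring H) {f})"
      and f: "f \<in> idealJ_torus m H L" "unique_min w f a0" for w f a0
  proof -
    have no_min: "\<not> unique_min w F a" if "F \<in> T \<union> \<Lambda>" for F a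
      using trop that sub J_laurent by (intro trop_hypersurface_imp[of F H w]) auto
    have w_deg: "weight w a = weight w b"
      if "a \<in> nonneg_exps H" "b \<in> nonneg_exps H" "monomial_degree a = monomial_degree b" for a b
      by (rule weight_determined_by_degree[OF T no_min that]) auto
    let ?\<omega> = "induced_weight w"
    have \<omega>: "?\<omega> (monomial_degree a) = weight w a" if "a \<in> nonneg_exps H" for a
      unfolding induced_weight_def by (rule w_deg) (simp_all add: that lift_exp degree_nonneg)
    obtain b where b: "single b 1 * f \<in> idealJ m H L"
      using idealJ_torus_clear_denominators[OF idealJ_is_ideal f(1)] by blast
    define F where "F = single b 1 * f"
    define a where "a = b + a0"
    have F: "F \<in> idealJ m H L" "unique_min w F a"
      using b unique_min_shift[OF f(2)] by (auto simp: F_def a_def)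
    have a: "a \<in> keys F" and less: "\<And>b. b \<in> keys F \<Longrightarrow> b \<noteq> a \<Longrightarrow> weight w a < weight w b"
      using F(2) by (auto simp: unique_min_def)
    have keys_F: "keys F \<subseteq> nonneg_exps H" using F(1) by (auto simp: idealJ_iff poly_ring_def)
    obtain u0 v0 where uv0: "monomial_degree a = (u0, v0)" by (cases "monomial_degree a")
    define h where "h = fiber u0 (to_algC F)"
    have h: "h \<in> line_ideal m L" using F(1) by (simp add: h_def idealJ_iff vanishing_def)
    have keys_h: "\<exists>b\<in>keys F. monomial_degree b = (u0, v)" if "v \<in> keys h" for v
    proof -
      have "(u0, v) \<in> monomial_degree ` keys F"
        using that keys_pushforward[of monomial_degree F] unfolding h_def keys_fiber to_algC_eq by blast
      then show ?thesis by (metis imageE)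
    qed
    have hC: "(u0, v) \<in> C" if "v \<in> keys h" for v
      using keys_h[OF that] keys_F degree_nonneg by force
    \<comment> \<open>Terms of the degree of \<open>a\<close> have the weight of \<open>a\<close>, so only \<open>a\<close> contributes to this coefficient.\<close>
    have "lookup h v0 = lin_ext (\<lambda>b. of_bool (b = a)) F"
      unfolding h_def lookup_fiber to_algC_eq lookup_pushforward
    proof (rule lin_ext_cong)
      fix b assume b: "b \<in> keys F"
      then have "a \<in> nonneg_exps H" "b \<in> nonneg_exps H" using a keys_F by blast+
      then have "monomial_degree b = (u0, v0) \<longleftrightarrow> b = a"
        using less[OF b] w_deg[of a b] uv0 by (metis less_irrefl)
      then show "(of_bool (monomial_degree b = (u0, v0)) :: 'k) = of_bool (b = a)" by simp
    qed
    also have "\<dots> = lookup F a"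
      using a by (simp add: lin_ext_def of_bool_def if_distrib sum.delta cong: if_cong)
    finally have v0: "v0 \<in> keys h" using a by (simp add: in_keys_iff)
    have less_h: "?\<omega> (u0, v0) < ?\<omega> (u0, v)" if "v \<in> keys h" "v \<noteq> v0" for v
    proof -
      obtain b where b: "b \<in> keys F" "monomial_degree b = (u0, v)" using keys_h[OF \<open>v \<in> keys h\<close>] by blast
      then have "b \<noteq> a" using uv0 that(2) by auto
      then have "weight w a < weight w b" using less b(1) by blast
      moreover have "?\<omega> (u0, v0) = weight w a" "?\<omega> (u0, v) = weight w b"
        using \<omega>[of a] \<omega>[of b] a b keys_F uv0 by auto
      ultimately show ?thesis by simp
    qed
    have "h \<noteq> 0" using v0 by auto
    then obtain v' where P: "(u0, v') \<in> lattP d m \<sigma> \<Delta>"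
      using lattP_nonempty[OF h, of u0 d \<sigma> \<Delta>] hC by blast
    define w' where "w' i = (if i \<in> {1..m} then ?\<omega> (u0, v' + var_exp i) - ?\<omega> (u0, v') else 0)" for i
    have diff: "?\<omega> (u, v) - ?\<omega> (u, v2) = weight w' v - weight w' v2" if "(u, v) \<in> C" "(u, v2) \<in> C" for u v v2
      unfolding w'_def by (rule induced_weight_difference[OF w_deg P that])
    have "unique_min w' h v0"
      unfolding unique_min_def
    proof (intro conjI ballI impI v0)
      fix v assume v: "v \<in> keys h" "v \<noteq> v0"
      show "weight w' v0 < weight w' v"
        using less_h[OF v] diff[OF hC[OF v(1)] hC[OF v0]] by simp
    qed
    moreover have w': "w' \<in> real_vecs {1..m}" by (auto simp: real_vecs_def w'_def)
    moreover have GI: "G \<subseteq> line_ideal m L" using basis by (simp add: tropical_basis_def)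
    moreover have I_laurent: "line_ideal m L \<subseteq> laurent_ring {1..m}" by (auto simp: line_ideal_iff)
    ultimately obtain g where g: "g \<in> G" "w' \<notin> trop {1..m} (ideal_gen (laurent_ring {1..m}) {g})"
      using basis h unfolding tropical_basis_iff[OF line_ideal_is_ideal I_laurent GI] by blast
    then obtain e where e: "unique_min w' g e"
      using trop_hypersurface_iff[of g "{1..m}" w'] w' GI I_laurent by blast
    obtain pu pv where p: "(pu, pv) \<in> Ps"
      using P Ps unfolding module_generators_def by fastforce
    have "times_chi (g * single pv 1) pu \<in> gens" using g(1) p unfolding tilde_generators_def by blast
    then obtain F' where F': "F' \<in> \<Lambda>" "to_algC F' = times_chi (g * single pv 1) pu"
      using \<Lambda>(1) unfolding lifts_def by (metis imageE)
    have keys_deg: "monomial_degree ` keys F' = (\<lambda>e. (pu, pv + e)) ` keys g"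
      using keys_pushforward_inj[of monomial_degree F'] \<Lambda>(2) F'
        keys_pushforward_inj[of "\<lambda>e. (pu, pv + e)" g]
      by (simp add: termwise_def to_algC_eq times_chi_shift inj_on_def)
    have F'_nonneg: "keys F' \<subseteq> nonneg_exps H"
      using \<Lambda>(1) F'(1) by (auto simp: lifts_def poly_ring_def)
    have "e \<in> keys g" using e by (simp add: unique_min_def)
    then obtain b where b: "b \<in> keys F'" "monomial_degree b = (pu, pv + e)"
      using keys_deg by (metis (no_types, lifting) imageE imageI)
    have "unique_min w F' b"
      unfolding unique_min_def
    proof (intro conjI ballI impI b(1))
      fix b' assume b': "b' \<in> keys F'" "b' \<noteq> b"
      obtain e' where e': "e' \<in> keys g" "monomial_degree b' = (pu, pv + e')"
        using keys_deg b'(1) by (metis (no_types, lifting) imageE imageI)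
      have "inj_on monomial_degree (keys F')" using \<Lambda>(2) F'(1) by (simp add: termwise_def)
      then have "monomial_degree b' \<noteq> monomial_degree b" using b(1) b' by (metis inj_onD)
      then have "e' \<noteq> e" using b(2) e'(2) by auto
      then have "weight w' e < weight w' e'" using e e'(1) by (simp add: unique_min_def)
      moreover have "weight w b = ?\<omega> (pu, pv + e)" "weight w b' = ?\<omega> (pu, pv + e')"
        using \<omega>[of b] \<omega>[of b'] b b'(1) e'(2) F'_nonneg by auto
      moreover have "(pu, pv + e) \<in> C" "(pu, pv + e') \<in> C"
        using b b'(1) e'(2) F'_nonneg degree_nonneg by (metis subsetD)+
      ultimately show "weight w b < weight w b'"
        using diff[of pu "pv + e'" "pv + e"] by (simp add: weight_add)
    qed
    then show False using no_min[of F' b] F'(1) by blast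
  qed
  moreover have "idealJ_torus m H L \<subseteq> laurent_ring H"
    unfolding idealJ_torus_def by (rule laurent_ideal_gen_subset[OF J_laurent])
  moreover have "T \<union> \<Lambda> \<subseteq> idealJ_torus m H L"
    using sub idealJ_subset_torus by blast
  ultimately show ?thesis
    by (subst tropical_basis_iff[OF idealJ_torus_is_ideal]) blast+
qed

end

lemma alg_closed_field_infinite: "infinite (UNIV :: 'k::alg_closed_field set)"
proof
  assume fin: "finite (UNIV :: 'k set)"
  \<comment> \<open>A finite field has a polynomial that is constantly \<open>1\<close> and not a constant.\<close>
  define q where "q = (\<Prod>a\<in>(UNIV :: 'k set). [:- a, 1:])"
  have "degree q = card (UNIV :: 'k set)"
    unfolding q_def by (subst degree_prod_eq_sum_degree) auto
  then have "degree q > 0" using fin by (simp add: card_gt_0_iff)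
  then have "degree (q + 1) > 0" by (simp add: degree_add_eq_left)
  then obtain x where "poly (q + 1) x = 0" using alg_closed_imp_poly_has_root by blast
  moreover have "poly q x = 0"
    using fin by (auto simp: q_def poly_prod intro!: prod_zero)
  ultimately show False by simp
qed

theorem corollary4p6:
  fixes d m :: nat
    and \<sigma> :: "qvec set" and \<Delta> :: "nat \<Rightarrow> qvec set"
    and H Ps :: "(zvec \<times> zvec) set"
    and L :: "(nat \<Rightarrow> 'k::alg_closed_field) set"
    and G :: "(nat, 'k) laurent set"
  assumes "rat_polyhedral_cone d \<sigma>" and "pointed_cone \<sigma>"
    and "\<forall>i\<le>m. \<Delta> i = {} \<or> rat_polyhedron d (\<Delta> i) \<and> tailcone (\<Delta> i) = \<sigma>"
    and "(\<Sum>i\<le>m. \<Delta> i) \<subset> \<sigma>"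
    and "projective_line m L" and "line_torus m L \<noteq> {}"
    and "finite H" and "monoid_generators d m \<sigma> \<Delta> H"
    and "module_generators d m \<sigma> \<Delta> Ps"
    and "tropical_basis {1..m} (line_ideal m L) G"
    and "\<forall>g\<in>G. \<exists>c. g = dehom_linear_form m c"
  shows
    \<comment> \<open>the listed elements generate the ideal of \<open>X(L)\<close> in \<open>A(C)\<close>\<close>
    "tilde_generators G Ps \<subseteq> algC d m \<sigma> \<Delta> \<and>
     ideal_gen (algC d m \<sigma> \<Delta>) (tilde_generators G Ps) = ideal_tilde d m \<sigma> \<Delta> L \<and>
     \<comment> \<open>generators of the toric ideal together with arbitrary lifts generate \<open>J(L)\<close>\<close>
     (\<forall>T \<Lambda>. T \<subseteq> poly_ring H \<and> ideal_gen (poly_ring H) T = toric_ideal H \<and>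
            lifts H (tilde_generators G Ps) \<Lambda>
        \<longrightarrow> ideal_gen (poly_ring H) (T \<union> \<Lambda>) = idealJ m H L) \<and>
     \<comment> \<open>binomial generators and termwise lifts form a tropical basis\<close>
     (\<forall>T \<Lambda>. T \<subseteq> binomials H \<and> ideal_gen (poly_ring H) T = toric_ideal H \<and>
            lifts H (tilde_generators G Ps) \<Lambda> \<and> (\<forall>F\<in>\<Lambda>. termwise F)
        \<longrightarrow> tropical_basis H (idealJ_torus m H L) (T \<union> \<Lambda>)) \<and>
     \<comment> \<open>such generators and lifts exist\<close>
     (\<exists>T \<Lambda>. T \<subseteq> binomials H \<and> ideal_gen (poly_ring H) T = (toric_ideal H :: (_, 'k) laurent set) \<and>
            lifts H (tilde_generators G Ps) \<Lambda> \<and> (\<forall>F\<in>\<Lambda>. termwise F))"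
proof -
  obtain b t r where "torus_line m b t r L"
    using torus_line_exists[OF alg_closed_field_infinite assms(5,6)] by blast
  then interpret torus_line m b t r L .
  interpret embedded_line m b t r L d \<sigma> \<Delta> H Ps G
    by unfold_locales (fact assms(8-11))+
  obtain \<Lambda> where \<Lambda>: "lifts H gens \<Lambda>" "\<forall>F\<in>\<Lambda>. termwise F" using termwise_lifts_exist by blast
  show ?thesis
  proof (intro conjI)
    show "\<exists>T \<Lambda>. T \<subseteq> binomials H \<and> ideal_gen (poly_ring H) T = (toric_ideal H :: (_, 'k) laurent set) \<and>
        lifts H gens \<Lambda> \<and> (\<forall>F\<in>\<Lambda>. termwise F)"
      using binomials_generate_toric_ideal \<Lambda>
      by (intro exI[of _ "binomials H \<inter> toric_ideal H"] exI[of _ \<Lambda>] conjI) auto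
  qed (use gens_algC gens_generate ideal_tilde_eq_vanishing lifts_generate_idealJ tropical_basis_lifts in auto)
qed

end
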